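(* Suppose that $\xi_1,\xi_2$ are countable ordinals, and let $\xi=\max\{\xi_1+\xi_2,\ \xi_2+\xi_1\}$. If $K$ is a compact metric space such that $K^{(\omega^{\xi})}\neq\emptyset$, then $$\sup\{\beta(fg): f\in\mathfrak{B}_1^{\xi_1}(K),\ g\in\mathfrak{B}_1^{\xi_2}(K)\}=\omega^{\xi}.$$
   Context: Derived sets: for a closed subset $H$ of $K$, $H'$ is the set of all limit points of $H$; $H^{(0)}=H$, $H^{(\alpha+1)}=(H^{(\alpha)})'$, and $H^{(\alpha)}=\bigcap_{\alpha'<\alpha}H^{(\alpha')}$ for limit ordinals $\alpha$. A function on a compact metric space is Baire-1 if it is the pointwise limit of a sequence of real-valued continuous functions. $\mathfrak{B}_1(K)$ is the set of all (not necessarily bounded) real-valued Baire-1 functions on $K$. Oscillation index. Let $H$ be a compact metric space, $f$ a real-valued function whose domain contains $H$, and $\varepsilon>0$. Put $H^0(f,\varepsilon)=H$. For a countable ordinal $\alpha$, $H^{\alpha+1}(f,\varepsilon)$ is the set of all $x\in H^\alpha(f,\varepsilon)$ such that for every open set $U$ containing $x$ there are $x_1,x_2\in U\cap H^\alpha(f,\varepsilon)$ with $|f(x_1)-f(x_2)|\ge\varepsilon$. For a countable limit ordinal $\alpha$, $H^\alpha(f,\varepsilon)=\bigcap_{\alpha'<\alpha}H^{\alpha'}(f,\varepsilon)$. Let $\beta_H(f,\varepsilon)$ be the least countable $\alpha$ with $H^\alpha(f,\varepsilon)=\emptyset$ if such $\alpha$ exists, and $\omega_1$ otherwise; $\beta_H(f)=\sup_{\varepsilon>0}\beta_H(f,\varepsilon)$.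 Write $\beta$ for $\beta_K$. For a countable ordinal $\xi$: $\mathfrak{B}_1^\xi(K)=\{f\in\mathfrak{B}_1(K):\beta(f)\le\omega^\xi\}$. Ordinal sums and powers are in the sense of ordinal arithmetic. *)

theory Defs
  imports "HOL-Analysis.Analysis"
begin

unbundle cardinal_syntax

section \<open>Ordinals\<close>

text \<open>
  The library has well-orders but no type of ordinals. Here \<open>ordinal\<close> is the type of all ordinals
  below \<open>\<omega>\<^sub>2\<close>: its carrier is the field of \<open>\<omega>\<^sub>2 = cardSuc (cardSuc natLeq)\<close>, an ordinal being
  identified with its position in that well-order. Thus it contains all countable ordinals and
  \<open>\<omega>\<^sub>1\<close>, and every subset of cardinality at most \<open>\<aleph>\<^sub>1\<close> has a supremum (\<open>bdd_above_le_aleph1\<close> below).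
\<close>

definition w2_rel :: "nat set set rel"
  where "w2_rel = cardSuc (cardSuc natLeq)"

lemma w2_Card_order: "Card_order w2_rel"
  and w2_Well_order: "Well_order w2_rel"
  and w2_infinite: "infinite (Field w2_rel)"
  and w2_regular: "regularCard w2_rel"
proof -
  have c1: "Card_order (cardSuc natLeq)"
    by (simp add: cardSuc_Card_order natLeq_Card_order)
  have i1: "infinite (Field (cardSuc natLeq))"
    using cardSuc_finite[OF natLeq_Card_order] by (simp add: Field_natLeq)
  show c2: "Card_order w2_rel"
    unfolding w2_rel_def by (rule cardSuc_Card_order[OF c1])
  show "Well_order w2_rel"
    using c2 by (rule card_order_on_well_order_on)
  show "infinite (Field w2_rel)"
    unfolding w2_rel_def using cardSuc_finite[OF c1] i1 by simp
  show "regularCard w2_rel"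
    unfolding w2_rel_def by (rule infinite_cardSuc_regularCard[OF i1 c1])
qed

typedef ordinal = "Field w2_rel"
  using w2_infinite by (metis finite.emptyI ex_in_conv)

setup_lifting type_definition_ordinal

instantiation ordinal :: linorder
begin

lift_definition less_eq_ordinal :: "ordinal \<Rightarrow> ordinal \<Rightarrow> bool"
  is "\<lambda>x y. (x, y) \<in> w2_rel" .

definition less_ordinal :: "ordinal \<Rightarrow> ordinal \<Rightarrow> bool"
  where "less_ordinal x y \<longleftrightarrow> x \<le> y \<and> \<not> y \<le> x"

instance
proof
  note w = w2_Well_order[unfolded well_order_on_def linear_order_on_def partial_order_on_def
      preorder_on_def]
  fix x y z :: ordinal
  show "x < y \<longleftrightarrow> x \<le> y \<and> \<not> y \<le> x"
    by (simp add: less_ordinal_def)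
  show "x \<le> x"
    using w Rep_ordinal[of x] unfolding less_eq_ordinal.rep_eq refl_on_def by blast
  show "x \<le> y \<Longrightarrow> y \<le> z \<Longrightarrow> x \<le> z"
    using w unfolding less_eq_ordinal.rep_eq trans_def by blast
  show "x \<le> y \<Longrightarrow> y \<le> x \<Longrightarrow> x = y"
    using w unfolding less_eq_ordinal.rep_eq antisym_def Rep_ordinal_inject[symmetric] by blast
  show "x \<le> y \<or> y \<le> x"
    using w Rep_ordinal[of x] Rep_ordinal[of y]
    unfolding less_eq_ordinal.rep_eq refl_on_def total_on_def by metis
qed

end

lemma less_ordinal_iff: "x < y \<longleftrightarrow> (Rep_ordinal x, Rep_ordinal y) \<in> w2_rel - Id"
  for x y :: ordinal
proof -
  have "x < y \<longleftrightarrow> x \<le> y \<and> x \<noteq> y"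
    by (rule less_le)
  then show ?thesis
    by (simp add: less_eq_ordinal.rep_eq Rep_ordinal_inject)
qed

instance ordinal :: wellorder
proof
  fix P :: "ordinal \<Rightarrow> bool" and a
  assume step: "\<And>x. (\<And>y. y < x \<Longrightarrow> P y) \<Longrightarrow> P x"
  have "wf (w2_rel - Id)"
    using w2_Well_order by (simp add: well_order_on_def)
  then have "wf (inv_image (w2_rel - Id) Rep_ordinal)"
    by (rule wf_inv_image)
  then show "P a"
    by (induction a rule: wf_induct_rule) (rule step, auto simp: less_ordinal_iff)
qed

text \<open>\<open>Sup A\<close> is the least upper bound; it is meaningful for sets that are bounded above.\<close>

instantiation ordinal :: conditionally_complete_linorder
begin

definition Sup_ordinal :: "ordinal set \<Rightarrow> ordinal"
  where "Sup_ordinal A = (LEAST u. \<forall>a\<in>A. a \<le> u)"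

definition Inf_ordinal :: "ordinal set \<Rightarrow> ordinal"
  where "Inf_ordinal A = (LEAST a. a \<in> A)"

definition inf_ordinal :: "ordinal \<Rightarrow> ordinal \<Rightarrow> ordinal"
  where "inf_ordinal = min"

definition sup_ordinal :: "ordinal \<Rightarrow> ordinal \<Rightarrow> ordinal"
  where "sup_ordinal = max"

instance
proof
  fix x y z :: ordinal and X :: "ordinal set"
  show "inf x y \<le> x" "inf x y \<le> y" "x \<le> y \<Longrightarrow> x \<le> z \<Longrightarrow> x \<le> inf y z"
    by (simp_all add: inf_ordinal_def)
  show "x \<le> sup x y" "y \<le> sup x y" "y \<le> x \<Longrightarrow> z \<le> x \<Longrightarrow> sup y z \<le> x"
    by (simp_all add: sup_ordinal_def)
  show "x \<in> X \<Longrightarrow> bdd_below X \<Longrightarrow> Inf X \<le> x"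
    by (simp add: Inf_ordinal_def Least_le)
  show "X \<noteq> {} \<Longrightarrow> (\<And>x. x \<in> X \<Longrightarrow> z \<le> x) \<Longrightarrow> z \<le> Inf X"
    unfolding Inf_ordinal_def by (metis LeastI ex_in_conv)
  show "x \<le> Sup X" if "x \<in> X" "bdd_above X"
  proof -
    from that(2) obtain u where "\<forall>a\<in>X. a \<le> u"
      by (auto simp: bdd_above_def)
    then have "\<forall>a\<in>X. a \<le> Sup X"
      unfolding Sup_ordinal_def by (rule LeastI)
    with that(1) show ?thesis by simp
  qed
  show "X \<noteq> {} \<Longrightarrow> (\<And>x. x \<in> X \<Longrightarrow> x \<le> z) \<Longrightarrow> Sup X \<le> z"
    unfolding Sup_ordinal_def by (rule Least_le) auto
qed

end

instance ordinal :: no_top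
proof
  fix x :: ordinal
  obtain b where "b \<in> Field w2_rel" "Rep_ordinal x \<noteq> b" "(Rep_ordinal x, b) \<in> w2_rel"
    using infinite_Card_order_limit[OF w2_Card_order w2_infinite Rep_ordinal] by blast
  then have "x < Abs_ordinal b"
    by (simp add: less_ordinal_iff Abs_ordinal_inverse)
  then show "\<exists>y. x < y" ..
qed

lemma bdd_above_less_aleph2:
  fixes A :: "ordinal set"
  assumes "|A| <o w2_rel"
  shows "bdd_above A"
proof (rule ccontr)
  assume unb: "\<not> bdd_above A"
  have "cofinal (Rep_ordinal ` A) w2_rel"
    unfolding cofinal_def
  proof
    fix a assume a: "a \<in> Field w2_rel"
    obtain y where "y \<in> A" "Abs_ordinal a < y"
      using unb by (auto simp: bdd_above_def not_le)
    with a show "\<exists>b\<in>Rep_ordinal ` A. a \<noteq> b \<and> (a, b) \<in> w2_rel"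
      by (force simp: less_ordinal_iff Abs_ordinal_inverse)
  qed
  then have "|Rep_ordinal ` A| =o w2_rel"
    using w2_regular Rep_ordinal unfolding regularCard_def by (simp add: image_subset_iff)
  moreover have "|Rep_ordinal ` A| <o w2_rel"
    using card_of_image assms by (rule ordLeq_ordLess_trans)
  ultimately show False
    using not_ordLess_ordIso by blast
qed

lemma bdd_above_le_aleph1:
  fixes A :: "ordinal set"
  assumes "|A| \<le>o cardSuc natLeq"
  shows "bdd_above A"
proof -
  have "|A| \<le>o cardSuc natLeq \<longleftrightarrow> |A| <o w2_rel"
    unfolding w2_rel_def
    by (simp add: cardSuc_ordLeq_ordLess cardSuc_Card_order natLeq_Card_order card_of_Card_order)
  with assms show ?thesis
    by (simp add: bdd_above_less_aleph2)
qed

lemma lessThan_less_aleph2: "|{..<\<alpha>::ordinal}| <o w2_rel"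
proof -
  have "|{..<\<alpha>}| \<le>o |underS w2_rel (Rep_ordinal \<alpha>)|"
    by (rule card_of_ordLeqI[where f = Rep_ordinal])
      (auto simp: inj_on_def Rep_ordinal_inject underS_def less_ordinal_iff)
  also have "|underS w2_rel (Rep_ordinal \<alpha>)| <o w2_rel"
    by (rule card_of_underS[OF w2_Card_order Rep_ordinal])
  finally show ?thesis .
qed

lemma bdd_above_image_lessThan: "bdd_above (f ` {..<\<alpha>})" for f :: "ordinal \<Rightarrow> ordinal"
  by (rule bdd_above_less_aleph2, rule ordLeq_ordLess_trans[OF card_of_image lessThan_less_aleph2])

instantiation ordinal :: "{zero, one}"
begin

definition zero_ordinal :: ordinal
  where "(0::ordinal) = (LEAST \<alpha>. True)"

definition one_ordinal :: ordinal
  where "(1::ordinal) = (LEAST \<alpha>. 0 < \<alpha>)"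

instance ..

end

definition osuc :: "ordinal \<Rightarrow> ordinal"
  where "osuc \<alpha> = (LEAST \<beta>. \<alpha> < \<beta>)"

definition is_limit :: "ordinal \<Rightarrow> bool"
  where "is_limit \<alpha> \<longleftrightarrow> \<alpha> \<noteq> 0 \<and> (\<nexists>\<beta>. \<alpha> = osuc \<beta>)"

definition omega :: ordinal  (\<open>\<omega>\<close>)
  where "\<omega> = (LEAST \<alpha>. infinite {..<\<alpha>})"

definition omega1 :: ordinal  (\<open>\<omega>\<^sub>1\<close>)
  where "\<omega>\<^sub>1 = (LEAST \<alpha>. uncountable {..<\<alpha>})"

lemma zero_le_ordinal [simp]: "0 \<le> \<alpha>" for \<alpha> :: ordinal
  by (simp add: zero_ordinal_def Least_le)

lemma less_osuc [simp]: "\<alpha> < osuc \<alpha>"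
proof -
  obtain \<beta> where "\<alpha> < \<beta>"
    using gt_ex by blast
  then show ?thesis
    unfolding osuc_def by (rule LeastI)
qed

lemma osuc_le_iff: "osuc \<alpha> \<le> \<beta> \<longleftrightarrow> \<alpha> < \<beta>"
proof
  show "osuc \<alpha> \<le> \<beta> \<Longrightarrow> \<alpha> < \<beta>"
    using less_osuc by (rule less_le_trans)
  show "\<alpha> < \<beta> \<Longrightarrow> osuc \<alpha> \<le> \<beta>"
    unfolding osuc_def by (rule Least_le)
qed

lemma osuc_inject [simp]: "osuc \<alpha> = osuc \<beta> \<longleftrightarrow> \<alpha> = \<beta>"
proof
  assume eq: "osuc \<alpha> = osuc \<beta>"
  have "\<not> \<alpha> < \<beta>"
    using eq less_osuc[of \<beta>] osuc_le_iff[of \<alpha> \<beta>] by (simp add: not_less[symmetric])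
  moreover have "\<not> \<beta> < \<alpha>"
    using eq less_osuc[of \<alpha>] osuc_le_iff[of \<beta> \<alpha>] by (simp add: not_less[symmetric])
  ultimately show "\<alpha> = \<beta>" by simp
qed simp

lemma osuc_neq_zero [simp]: "osuc \<alpha> \<noteq> 0"
  using le_less_trans[OF zero_le_ordinal less_osuc] by (rule less_imp_neq[symmetric])

lemma one_ordinal_eq: "1 = osuc 0"
  by (simp add: one_ordinal_def osuc_def)

lemma uncountable_lessThan_omega1: "uncountable {..<\<omega>\<^sub>1}"
proof -
  have "cardSuc natLeq <o w2_rel"
    unfolding w2_rel_def by (simp add: cardSuc_Card_order cardSuc_greater natLeq_Card_order)
  then obtain a where a: "a \<in> Field w2_rel" "cardSuc natLeq =o Restr w2_rel (underS w2_rel a)"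
    using ordLess_iff_ordIso_Restr[OF w2_Well_order cardSuc_Well_order[OF natLeq_Card_order]]
    by blast
  have "Field (Restr w2_rel (underS w2_rel a)) = underS w2_rel a"
    using w2_Well_order
    by (simp add: Field_Restr_ofilter wo_rel.underS_ofilter wo_rel_def)
  then have eq: "|Field (cardSuc natLeq)| =o |underS w2_rel a|"
    using card_of_cong[OF a(2)] by simp
  have "uncountable {..<Abs_ordinal a}"
  proof
    assume c: "countable {..<Abs_ordinal a}"
    have "underS w2_rel a \<subseteq> Rep_ordinal ` {..<Abs_ordinal a}"
    proof
      fix b assume b: "b \<in> underS w2_rel a"
      then have "b \<in> Field w2_rel"
        by (auto simp: underS_def Field_def)
      with a(1) b show "b \<in> Rep_ordinal ` {..<Abs_ordinal a}"
        by (intro image_eqI[of _ _ "Abs_ordinal b"])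
          (auto simp: underS_def less_ordinal_iff Abs_ordinal_inverse)
    qed
    with c have "countable (underS w2_rel a)"
      by (meson countable_image countable_subset)
    then have "|underS w2_rel a| \<le>o natLeq"
      by (metis card_of_nat card_of_ordLeqI countableE ordLeq_ordIso_trans UNIV_I)
    then have "cardSuc natLeq \<le>o natLeq"
      using eq card_of_Field_ordIso[OF cardSuc_Card_order[OF natLeq_Card_order]]
      by (meson ordIso_ordLeq_trans ordIso_symmetric)
    then show False
      using cardSuc_greater[OF natLeq_Card_order] not_ordLess_ordLeq by blast
  qed
  then show ?thesis
    unfolding omega1_def by (rule LeastI)
qed

lemma less_omega1_iff_countable: "\<alpha> < \<omega>\<^sub>1 \<longleftrightarrow> countable {..<\<alpha>}"
proof
  show "\<alpha> < \<omega>\<^sub>1 \<Longrightarrow> countable {..<\<alpha>}"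
    unfolding omega1_def by (drule not_less_Least) simp
  assume "countable {..<\<alpha>}"
  then have "\<not> {..<\<omega>\<^sub>1} \<subseteq> {..<\<alpha>}"
    using uncountable_lessThan_omega1 countable_subset by blast
  then show "\<alpha> < \<omega>\<^sub>1" by auto
qed

subsection \<open>Transfinite recursion\<close>

text \<open>
  \<open>trec z s l\<close> starts with \<open>z\<close>, applies \<open>s\<close> at successors, and applies \<open>l\<close> to the set of all
  previous values at limits.
\<close>

function trec :: "'b \<Rightarrow> ('b \<Rightarrow> 'b) \<Rightarrow> ('b set \<Rightarrow> 'b) \<Rightarrow> ordinal \<Rightarrow> 'b" where
  "trec z s l \<alpha> =
    (if \<alpha> = 0 then z
     else if \<exists>\<beta>. \<alpha> = osuc \<beta> then s (trec z s l (THE \<beta>. \<alpha> = osuc \<beta>))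
     else l ((\<lambda>\<beta>. trec z s l \<beta>) ` {..<\<alpha>}))"
  by auto
termination
  by (relation "inv_image {(\<alpha>, \<beta>). \<alpha> < \<beta>} (\<lambda>(z, s, l, \<alpha>). \<alpha>)") (auto simp: wf)

declare trec.simps [simp del]

lemma trec_zero [simp]: "trec z s l 0 = z"
  by (simp add: trec.simps)

lemma trec_osuc [simp]: "trec z s l (osuc \<alpha>) = s (trec z s l \<alpha>)"
  by (subst trec.simps) simp

lemma trec_limit: "is_limit \<alpha> \<Longrightarrow> trec z s l \<alpha> = l (trec z s l ` {..<\<alpha>})"
  by (subst trec.simps) (auto simp: is_limit_def)

subsection \<open>Ordinal arithmetic\<close>

instantiation ordinal :: "{plus, times}"
begin

definition plus_ordinal :: "ordinal \<Rightarrow> ordinal \<Rightarrow> ordinal"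
  where "\<alpha> + \<beta> = trec \<alpha> osuc Sup \<beta>"

definition times_ordinal :: "ordinal \<Rightarrow> ordinal \<Rightarrow> ordinal"
  where "\<alpha> * \<beta> = trec 0 (\<lambda>\<gamma>. \<gamma> + \<alpha>) Sup \<beta>"

instance ..

end

definition opow :: "ordinal \<Rightarrow> ordinal \<Rightarrow> ordinal"  (infixr \<open>^\<^sub>o\<close> 80)
  where "\<alpha> ^\<^sub>o \<beta> = trec 1 (\<lambda>\<gamma>. \<gamma> * \<alpha>) Sup \<beta>"


section \<open>Derived sets, oscillation index, Baire-1 functions\<close>

text \<open>
  A compact metric space is a compact subset of a type of class \<open>metric_space\<close>; for compact \<open>H\<close> the
  limit points of \<open>H\<close> in the ambient type all lie in \<open>H\<close>. Functions on \<open>K\<close> are total, and only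
  their values on \<open>K\<close> matter.
\<close>

definition derived_set :: "'a::metric_space set \<Rightarrow> ordinal \<Rightarrow> 'a set"
  where "derived_set H = trec H (\<lambda>A. {x. x islimpt A}) Inter"

definition osc_derivative :: "('a::metric_space \<Rightarrow> real) \<Rightarrow> real \<Rightarrow> 'a set \<Rightarrow> 'a set"
  where "osc_derivative f \<epsilon> A =
    {x \<in> A. \<forall>U. open U \<and> x \<in> U \<longrightarrow> (\<exists>x1\<in>U \<inter> A. \<exists>x2\<in>U \<inter> A. \<bar>f x1 - f x2\<bar> \<ge> \<epsilon>)}"

definition osc_set :: "'a::metric_space set \<Rightarrow> ('a \<Rightarrow> real) \<Rightarrow> real \<Rightarrow> ordinal \<Rightarrow> 'a set"
  where "osc_set H f \<epsilon> = trec H (osc_derivative f \<epsilon>) Inter"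

definition osc_index_eps :: "'a::metric_space set \<Rightarrow> ('a \<Rightarrow> real) \<Rightarrow> real \<Rightarrow> ordinal"
  where "osc_index_eps H f \<epsilon> =
    (if \<exists>\<alpha><\<omega>\<^sub>1. osc_set H f \<epsilon> \<alpha> = {} then LEAST \<alpha>. osc_set H f \<epsilon> \<alpha> = {} else \<omega>\<^sub>1)"

definition osc_index :: "'a::metric_space set \<Rightarrow> ('a \<Rightarrow> real) \<Rightarrow> ordinal"
  where "osc_index H f = (SUP \<epsilon>\<in>{0<..}. osc_index_eps H f \<epsilon>)"

lemma osc_index_eps_le_omega1: "osc_index_eps H f \<epsilon> \<le> \<omega>\<^sub>1"
  unfolding osc_index_eps_def by (auto intro: Least_le order_trans less_imp_le)

lemma osc_index_le_omega1: "osc_index H f \<le> \<omega>\<^sub>1"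
  unfolding osc_index_def
  by (rule cSUP_least) (auto simp: osc_index_eps_le_omega1 intro: gt_ex)

definition baire1 :: "'a::metric_space set \<Rightarrow> ('a \<Rightarrow> real) set"
  where "baire1 K = {f. \<exists>F :: nat \<Rightarrow> 'a \<Rightarrow> real.
    (\<forall>n. continuous_on K (F n)) \<and> (\<forall>x\<in>K. (\<lambda>n. F n x) \<longlonglongrightarrow> f x)}"

definition baire1_class :: "ordinal \<Rightarrow> 'a::metric_space set \<Rightarrow> ('a \<Rightarrow> real) set"
  where "baire1_class \<xi> K = {f \<in> baire1 K. osc_index K f \<le> \<omega> ^\<^sub>o \<xi>}"

end

theory Submission
  imports Defs
begin

text \<open>
  Oscillation indices are handled by ranks: the \<open>\<theta>\<close>-th oscillation set of \<open>f\<close> at scale \<open>\<epsilon>\<close> is empty if and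
  only if there is an upper semicontinuous function into the ordinals below \<open>\<theta>\<close> such that \<open>f\<close> oscillates
  by less than \<open>\<epsilon>\<close> near each point on its level set (\<open>osc_set_empty_if_rank\<close>, \<open>local_rank_osc_rank\<close>).

  Upper bound. The oscillation of \<open>f * g\<close> is at most \<open>\<bar>f y\<bar> * \<bar>g y - g z\<bar> + \<bar>g z\<bar> * \<bar>f y - f z\<bar>\<close>. For the first
  term, the rank \<open>a < \<omega> ^\<^sub>o \<xi>1\<close> of \<open>f\<close> at scale 1 divides \<open>K\<close> into layers on which \<open>f\<close> is locally bounded,
  and inside a layer the rank \<open>b < \<omega> ^\<^sub>o \<xi>2\<close> of \<open>g\<close> at a scale adapted to the local bound suffices. So
  \<open>\<omega> ^\<^sub>o \<xi>2 * a + b\<close> is a rank for this term, below \<open>\<omega> ^\<^sub>o (\<xi>2 + \<xi>1)\<close> (\<open>product_rank\<close>). The second term is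
  symmetric. Two ranks are combined by the natural sum of ordinals, which is strictly increasing in both
  arguments and does not lead out of a power of \<open>\<omega>\<close> (\<open>local_rank_nsum\<close>, \<open>nsum_less_opow\<close>).

  Lower bound. Let \<open>\<theta> < \<omega> ^\<^sub>o (\<xi>2 + \<xi>1)\<close>. A point of the \<open>\<theta>\<close>-th derived set is the root of a countable
  closed set \<open>L\<close> whose points have heights up to \<open>\<theta>\<close> and one of two colours, such that close to every
  point there are points of the other colour and of at least any given smaller height
  (\<open>layered_root_exists\<close>). The colour, as a function with values 0 and 1, has index above \<open>\<theta>\<close>. It is
  written as \<open>f * g\<close>, where on \<open>L\<close> the values of \<open>f\<close> are positive integers, locally constant on the layers
  of heights with the same quotient by \<open>\<omega> ^\<^sub>o \<xi>2\<close>, and \<open>g\<close> is \<open>1 / f\<close> or 0. These integers tend to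
  infinity whenever a point is approached from lower layers. Hence near a point of \<open>L\<close> the function \<open>g\<close>
  exceeds a given scale only inside the layer of that point, where the remainders below \<open>\<omega> ^\<^sub>o \<xi>2\<close>
  bound its index, while the index of \<open>f\<close> is bounded by the number of layers (\<open>product_witness_pos\<close>).
  If one exponent is 0, a constant factor and the colour suffice (\<open>single_witness\<close>).
\<close>

section \<open>Ordinal arithmetic\<close>

lemma not_less_zero [simp]: "\<not> \<alpha> < (0::ordinal)"
  by (simp add: not_less)

lemma zero_less_iff: "0 < \<alpha> \<longleftrightarrow> \<alpha> \<noteq> (0::ordinal)"
  by (auto simp: less_le)

lemma linorder_eqI_less: "(\<And>\<gamma>. \<gamma> < \<alpha> \<longleftrightarrow> \<gamma> < \<beta>) \<Longrightarrow> \<alpha> = (\<beta>::'a::linorder)"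
  by (metis less_irrefl linorder_less_linear)

lemma less_osuc_iff: "\<alpha> < osuc \<beta> \<longleftrightarrow> \<alpha> \<le> \<beta>"
  by (metis leD leI osuc_le_iff)

lemma limit_osuc_less: "is_limit \<kappa> \<Longrightarrow> \<alpha> < \<kappa> \<Longrightarrow> osuc \<alpha> < \<kappa>"
  unfolding is_limit_def by (metis le_less osuc_le_iff)

lemma limit_pos: "is_limit \<kappa> \<Longrightarrow> 0 < \<kappa>"
  by (simp add: is_limit_def less_le)

lemma ordinal_induct [case_names zero osuc limit]:
  assumes "P 0" "\<And>\<alpha>. P \<alpha> \<Longrightarrow> P (osuc \<alpha>)"
    and "\<And>\<kappa>. is_limit \<kappa> \<Longrightarrow> (\<And>\<beta>. \<beta> < \<kappa> \<Longrightarrow> P \<beta>) \<Longrightarrow> P \<kappa>"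
  shows "P (\<alpha>::ordinal)"
proof (induction \<alpha> rule: less_induct)
  case (less \<alpha>)
  then show ?case
    using assms less_osuc unfolding is_limit_def by metis
qed

definition normal :: "(ordinal \<Rightarrow> ordinal) \<Rightarrow> bool"
  where "normal F \<longleftrightarrow> (\<forall>\<alpha>. F \<alpha> < F (osuc \<alpha>)) \<and> (\<forall>\<kappa>. is_limit \<kappa> \<longrightarrow> F \<kappa> = Sup (F ` {..<\<kappa>}))"

lemma less_Sup_image_iff:
  "0 < \<kappa> \<Longrightarrow> \<gamma> < Sup (F ` {..<\<kappa>}) \<longleftrightarrow> (\<exists>\<beta><\<kappa>. \<gamma> < F \<beta>)" for F :: "ordinal \<Rightarrow> ordinal"
  by (subst less_cSup_iff) (auto simp: bdd_above_image_lessThan)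

lemma normal_less_limit_iff:
  "normal F \<Longrightarrow> is_limit \<kappa> \<Longrightarrow> \<gamma> < F \<kappa> \<longleftrightarrow> (\<exists>\<beta><\<kappa>. \<gamma> < F \<beta>)"
  by (simp add: normal_def less_Sup_image_iff limit_pos)

lemma normal_less:
  assumes "normal F" "\<alpha> < \<beta>"
  shows "F \<alpha> < F \<beta>"
  using assms(2)
proof (induction \<beta> rule: ordinal_induct)
  case (osuc \<beta>)
  then show ?case
    using assms(1) by (metis less_osuc_iff le_less less_trans normal_def)
next
  case (limit \<kappa>)
  then show ?case
    using assms(1) by (meson limit_osuc_less normal_def normal_less_limit_iff)
qed simp

lemma normal_less_iff: "normal F \<Longrightarrow> F \<alpha> < F \<beta> \<longleftrightarrow> \<alpha> < \<beta>"
  by (metis normal_less less_asym linorder_less_linear)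

lemma normal_le_iff: "normal F \<Longrightarrow> F \<alpha> \<le> F \<beta> \<longleftrightarrow> \<alpha> \<le> \<beta>"
  by (simp add: normal_less_iff flip: not_less)

lemma normal_increasing:
  assumes "normal F"
  shows "\<alpha> \<le> F \<alpha>"
proof (induction \<alpha> rule: less_induct)
  case (less \<alpha>)
  then show ?case
    using normal_less[OF assms] by (metis le_less_trans less_irrefl not_le)
qed

text \<open>
  Take the least \<open>\<beta>\<close> with \<open>\<gamma> < F \<beta>\<close>: continuity excludes a limit, so \<open>\<beta>\<close> is a successor. For addition this
  gives subtraction from the left, for multiplication the quotient of a division.
\<close>
lemma normal_bracket:
  assumes "normal F" "F 0 \<le> \<gamma>"
  obtains \<delta> where "F \<delta> \<le> \<gamma>" "\<gamma> < F (osuc \<delta>)"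
proof -
  define \<beta> where "\<beta> = (LEAST \<beta>. \<gamma> < F \<beta>)"
  have "\<gamma> < F (osuc \<gamma>)"
    using normal_increasing[OF assms(1), of "osuc \<gamma>"] by (simp add: osuc_le_iff)
  then have \<beta>: "\<gamma> < F \<beta>"
    unfolding \<beta>_def by (rule LeastI)
  have min: "F \<delta> \<le> \<gamma>" if "\<delta> < \<beta>" for \<delta>
    using that not_less_Least unfolding \<beta>_def by (metis not_le)
  have "\<beta> \<noteq> 0"
    using \<beta> assms(2) by auto
  moreover have "\<not> is_limit \<beta>"
    using \<beta> min normal_less_limit_iff[OF assms(1)] by (metis not_le)
  ultimately obtain \<delta> where "\<beta> = osuc \<delta>"
    by (auto simp: is_limit_def)
  with \<beta> min show thesis
    by (intro that) auto
qed

lemma normal_limit: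
  assumes "normal F" "is_limit \<kappa>"
  shows "is_limit (F \<kappa>)"
  unfolding is_limit_def
proof (intro conjI notI)
  have "F 0 < F \<kappa>"
    using assms by (simp add: normal_less_iff limit_pos)
  then show "F \<kappa> = 0 \<Longrightarrow> False"
    by simp
  assume "\<exists>\<beta>. F \<kappa> = osuc \<beta>"
  then obtain \<beta> where \<beta>: "F \<kappa> = osuc \<beta>" ..
  then obtain \<delta> where "\<delta> < \<kappa>" "\<beta> < F \<delta>"
    using normal_less_limit_iff[OF assms] less_osuc by metis
  then show False
    using \<beta> normal_less[OF assms(1)] by (metis osuc_le_iff not_le)
qed

lemma normal_comp:
  assumes F: "normal F" and G: "normal G"
  shows "normal (\<lambda>\<alpha>. F (G \<alpha>))"
  unfolding normal_def
proof (intro conjI allI impI)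
  show "F (G \<alpha>) < F (G (osuc \<alpha>))" for \<alpha>
    by (simp add: F G normal_less)
  fix \<kappa> assume l: "is_limit \<kappa>"
  show "F (G \<kappa>) = Sup ((\<lambda>\<alpha>. F (G \<alpha>)) ` {..<\<kappa>})"
  proof (rule linorder_eqI_less)
    fix \<gamma>
    have "\<gamma> < F (G \<kappa>) \<longleftrightarrow> (\<exists>\<beta><G \<kappa>. \<gamma> < F \<beta>)"
      using F normal_limit[OF G l] by (rule normal_less_limit_iff)
    also have "\<dots> \<longleftrightarrow> (\<exists>\<delta><\<kappa>. \<gamma> < F (G \<delta>))"
      using normal_less_limit_iff[OF G l] normal_less[OF F] normal_less[OF G]
      by (meson less_trans)
    finally show "\<gamma> < F (G \<kappa>) \<longleftrightarrow> \<gamma> < Sup ((\<lambda>\<alpha>. F (G \<alpha>)) ` {..<\<kappa>})"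
      using l by (simp add: less_Sup_image_iff limit_pos)
  qed
qed

text \<open>
  Normal functions are determined by a recursion at zero and successors. All the algebraic laws below
  follow from this, both sides being compositions of normal functions of the last variable.
\<close>
lemma normal_eqI:
  assumes "normal F" "normal G" "F 0 = G 0"
    and "\<And>\<alpha>. F \<alpha> = G \<alpha> \<Longrightarrow> F (osuc \<alpha>) = G (osuc \<alpha>)"
  shows "F \<alpha> = G \<alpha>"
proof (induction \<alpha> rule: ordinal_induct)
  case (limit \<kappa>)
  then have "F ` {..<\<kappa>} = G ` {..<\<kappa>}"
    by (intro image_cong) auto
  with limit assms(1,2) show ?case
    by (simp add: normal_def)
qed (use assms in auto)

subsection \<open>Sums, products and powers\<close>

lemma plus_zero [simp]: "\<alpha> + 0 = (\<alpha>::ordinal)"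
  and plus_osuc [simp]: "\<alpha> + osuc \<beta> = osuc (\<alpha> + \<beta>)"
  by (simp_all add: plus_ordinal_def)

lemma times_zero [simp]: "\<alpha> * 0 = (0::ordinal)"
  and times_osuc: "\<alpha> * osuc \<beta> = \<alpha> * \<beta> + (\<alpha>::ordinal)"
  by (simp_all add: times_ordinal_def)

lemma opow_zero [simp]: "\<alpha> ^\<^sub>o 0 = 1"
  and opow_osuc: "\<alpha> ^\<^sub>o osuc \<beta> = \<alpha> ^\<^sub>o \<beta> * \<alpha>"
  by (simp_all add: opow_def)

lemma normal_plus: "normal ((+) \<alpha>)"
  by (simp add: normal_def plus_ordinal_def[abs_def] trec_limit)

lemma zero_plus [simp]: "0 + \<alpha> = (\<alpha>::ordinal)"
proof (induction \<alpha> rule: ordinal_induct)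
  case (limit \<kappa>)
  show ?case
  proof (rule linorder_eqI_less)
    fix \<gamma>
    show "\<gamma> < 0 + \<kappa> \<longleftrightarrow> \<gamma> < \<kappa>"
      using limit by (metis less_osuc limit_osuc_less less_trans normal_less_limit_iff normal_plus)
  qed
qed auto

lemma times_one [simp]: "\<alpha> * 1 = (\<alpha>::ordinal)"
  by (simp add: one_ordinal_eq times_osuc)

lemma plus_less_cancel: "\<alpha> + \<beta> < \<alpha> + \<gamma> \<longleftrightarrow> \<beta> < (\<gamma>::ordinal)"
  by (rule normal_less_iff[OF normal_plus])

lemma plus_le_cancel: "\<alpha> + \<beta> \<le> \<alpha> + \<gamma> \<longleftrightarrow> \<beta> \<le> (\<gamma>::ordinal)"
  by (rule normal_le_iff[OF normal_plus])

lemma le_plus: "\<alpha> \<le> \<alpha> + (\<beta>::ordinal)"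
  using plus_le_cancel[of \<alpha> 0 \<beta>] by simp

lemma normal_times:
  assumes "0 < \<alpha>"
  shows "normal ((*) \<alpha>)"
  using assms plus_less_cancel[of _ 0 \<alpha>]
  by (auto simp: normal_def times_osuc) (simp add: times_ordinal_def[abs_def] trec_limit)

lemma plus_assoc: "\<alpha> + \<beta> + \<gamma> = \<alpha> + (\<beta> + (\<gamma>::ordinal))"
  by (rule normal_eqI[OF normal_plus normal_comp[OF normal_plus normal_plus]]) auto

lemma times_plus_distrib:
  fixes \<alpha> :: ordinal
  assumes "0 < \<alpha>"
  shows "\<alpha> * (\<beta> + \<gamma>) = \<alpha> * \<beta> + \<alpha> * \<gamma>"
  by (rule normal_eqI[OF normal_comp[OF normal_times normal_plus] normal_comp[OF normal_plus normal_times]])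
    (simp_all add: assms times_osuc plus_assoc)

lemma times_pos:
  fixes \<alpha> :: ordinal
  assumes "0 < \<alpha>" "0 < \<beta>"
  shows "0 < \<alpha> * \<beta>"
  using normal_less[OF normal_times[OF assms(1)] assms(2)] by simp

lemma times_assoc:
  fixes \<alpha> :: ordinal
  assumes "0 < \<alpha>" "0 < \<beta>"
  shows "\<alpha> * \<beta> * \<gamma> = \<alpha> * (\<beta> * \<gamma>)"
  by (rule normal_eqI[OF normal_times normal_comp[OF normal_times normal_times]])
    (simp_all add: assms times_pos times_osuc times_plus_distrib)

text \<open>
  The position of a natural number among the ordinals; the initial segment \<open>\<omega>\<close> is its range.
\<close>
fun onat :: "nat \<Rightarrow> ordinal" where
  "onat 0 = 0"
| "onat (Suc n) = osuc (onat n)"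

lemma onat_if_finite:
  assumes "finite {..<\<alpha>}"
  shows "\<alpha> \<in> range onat"
  using assms
proof (induction \<alpha> rule: ordinal_induct)
  case zero
  show ?case
    by (metis onat.simps(1) rangeI)
next
  case (osuc \<alpha>)
  have "{..<\<alpha>} \<subseteq> {..<osuc \<alpha>}"
    by (simp add: less_imp_le)
  with osuc.prems have "finite {..<\<alpha>}"
    by (rule finite_subset[rotated])
  with osuc show ?case
    by (metis onat.simps(2) rangeE rangeI)
next
  case (limit \<kappa>)
  have "{..<\<kappa>} \<noteq> {}"
    using limit_pos[OF limit(1)] by auto
  then have "Max {..<\<kappa>} < \<kappa>"
    using Max_in[OF limit.prems] by auto
  then have "osuc (Max {..<\<kappa>}) \<le> Max {..<\<kappa>}"
    using limit_osuc_less[OF limit.hyps] limit.prems by simp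
  then show ?case
    by (simp add: osuc_le_iff)
qed

lemma lessThan_osuc: "{..<osuc \<alpha>} = insert \<alpha> {..<\<alpha>}"
  by (auto simp: less_osuc_iff)

lemma finite_lessThan_onat: "finite {..<onat n}"
  by (induction n) (simp_all add: lessThan_osuc, simp add: lessThan_def)

lemma infinite_lessThan_omega: "infinite {..<\<omega>}"
  unfolding omega_def
  by (rule LeastI[of _ "\<omega>\<^sub>1"]) (use uncountable_lessThan_omega1 in \<open>auto dest: countable_finite\<close>)

lemma less_omega_iff: "\<alpha> < \<omega> \<longleftrightarrow> \<alpha> \<in> range onat"
proof
  show "\<alpha> \<in> range onat" if "\<alpha> < \<omega>"
    using that not_less_Least unfolding omega_def by (blast intro: onat_if_finite)
  assume "\<alpha> \<in> range onat"
  then have "finite {..<\<alpha>}"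
    by (auto simp: finite_lessThan_onat)
  then have "\<not> {..<\<omega>} \<subseteq> {..<\<alpha>}"
    using infinite_lessThan_omega finite_subset by blast
  then show "\<alpha> < \<omega>"
    by auto
qed

lemma limit_omega: "is_limit \<omega>"
proof -
  have "osuc \<alpha> < \<omega>" if "\<alpha> < \<omega>" for \<alpha>
    using that by (metis less_omega_iff onat.simps(2) rangeE rangeI)
  then have "\<omega> \<noteq> osuc \<alpha>" for \<alpha>
    by (metis less_irrefl less_osuc)
  moreover have "0 < \<omega>"
    by (metis less_omega_iff onat.simps(1) rangeI)
  ultimately show ?thesis
    by (auto simp: is_limit_def)
qed

lemma normal_opow: "normal ((^\<^sub>o) \<omega>)"
proof -
  have lim: "\<omega> ^\<^sub>o \<kappa> = Sup ((^\<^sub>o) \<omega> ` {..<\<kappa>})" if "is_limit \<kappa>" for \<kappa>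
    using that by (simp add: opow_def[abs_def] trec_limit)
  have pos: "0 < \<omega> ^\<^sub>o \<alpha>" for \<alpha>
  proof (induction \<alpha> rule: ordinal_induct)
    case (limit \<kappa>)
    then show ?case
      by (simp add: lim less_Sup_image_iff limit_pos) (use limit limit_pos in blast)
  qed (auto simp: one_ordinal_eq opow_osuc intro: times_pos limit_pos limit_omega)
  have "1 < \<omega>"
    by (simp add: one_ordinal_eq limit_osuc_less limit_omega limit_pos)
  then have "\<omega> ^\<^sub>o \<alpha> < \<omega> ^\<^sub>o osuc \<alpha>" for \<alpha>
    using normal_less[OF normal_times[OF pos]] by (metis opow_osuc times_one)
  with lim show ?thesis
    by (simp add: normal_def)
qed

lemma opow_pos: "0 < \<omega> ^\<^sub>o \<alpha>"
proof -
  have "1 \<le> \<omega> ^\<^sub>o \<alpha>"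
    using normal_le_iff[OF normal_opow, of 0 \<alpha>] by simp
  then show ?thesis
    by (simp add: one_ordinal_eq osuc_le_iff)
qed

lemma limit_opow:
  assumes "0 < \<xi>"
  shows "is_limit (\<omega> ^\<^sub>o \<xi>)"
proof (cases "is_limit \<xi>")
  case True
  then show ?thesis
    by (rule normal_limit[OF normal_opow])
next
  case False
  with assms obtain \<eta> where "\<xi> = osuc \<eta>"
    by (auto simp: is_limit_def)
  then show ?thesis
    using normal_limit[OF normal_times[OF opow_pos] limit_omega] by (simp add: opow_osuc)
qed

lemma opow_plus: "\<omega> ^\<^sub>o (\<alpha> + \<beta>) = \<omega> ^\<^sub>o \<alpha> * \<omega> ^\<^sub>o \<beta>"
  by (rule normal_eqI[OF normal_comp[OF normal_opow normal_plus]
        normal_comp[OF normal_times[OF opow_pos] normal_opow]])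
    (simp_all add: opow_osuc times_assoc opow_pos limit_pos limit_omega)

subsection \<open>Division with remainder\<close>

lemma ordinal_division:
  fixes \<theta> :: ordinal
  assumes "0 < \<theta>"
  obtains q r where "\<alpha> = \<theta> * q + r" "r < \<theta>"
proof -
  obtain q where q: "\<theta> * q \<le> \<alpha>" "\<alpha> < \<theta> * osuc q"
    using normal_bracket[OF normal_times[OF assms]] by (metis times_zero zero_le_ordinal)
  obtain r where "\<theta> * q + r \<le> \<alpha>" "\<alpha> < \<theta> * q + osuc r"
    using normal_bracket[OF normal_plus, of "\<theta> * q" \<alpha>] q by auto
  then have "\<alpha> = \<theta> * q + r"
    by (simp add: less_osuc_iff)
  with q that show thesis
    by (simp add: times_osuc plus_less_cancel)
qed

lemma division_less:
  fixes \<theta> :: ordinal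
  assumes "r < \<theta>" "q < q'"
  shows "\<theta> * q + r < \<theta> * q'"
proof -
  have "0 < \<theta>"
    using assms(1) by (rule le_less_trans[OF zero_le_ordinal])
  have "\<theta> * q + r < \<theta> * osuc q"
    using assms(1) by (simp add: times_osuc plus_less_cancel)
  also have "\<dots> \<le> \<theta> * q'"
    using assms(2) \<open>0 < \<theta>\<close> by (simp add: normal_le_iff[OF normal_times] osuc_le_iff)
  finally show ?thesis .
qed

lemma division_less_iff:
  fixes \<theta> :: ordinal
  assumes "r < \<theta>" "r' < \<theta>"
  shows "\<theta> * q + r < \<theta> * q' + r' \<longleftrightarrow> q < q' \<or> q = q' \<and> r < r'"
proof (cases q q' rule: linorder_cases)
  case less
  then show ?thesis
    using division_less[OF assms(1)] le_plus less_le_trans by blast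
next
  case equal
  then show ?thesis
    by (simp add: plus_less_cancel)
next
  case greater
  then have "\<not> \<theta> * q + r < \<theta> * q' + r'"
    using division_less[OF assms(2)] le_plus by (meson less_le_trans less_asym)
  with greater show ?thesis
    by auto
qed

subsection \<open>Closure of the countable ordinals\<close>

lemma osuc_less_omega1:
  assumes "\<alpha> < \<omega>\<^sub>1"
  shows "osuc \<alpha> < \<omega>\<^sub>1"
using assms by (simp add: less_omega1_iff_countable lessThan_osuc)

lemma trec_less_omega1:
  assumes "z < \<omega>\<^sub>1" "\<And>\<beta>. \<beta> < \<omega>\<^sub>1 \<Longrightarrow> s \<beta> < \<omega>\<^sub>1" "\<alpha> < \<omega>\<^sub>1"
  shows "trec z s Sup \<alpha> < \<omega>\<^sub>1"
  using assms(3)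
proof (induction \<alpha> rule: ordinal_induct)
  case (osuc \<alpha>)
  then have "\<alpha> < \<omega>\<^sub>1"
    using less_osuc by (blast intro: less_trans)
  with osuc.IH assms(2) show ?case
    by simp
next
  case (limit \<kappa>)
  have "{..<Sup (trec z s Sup ` {..<\<kappa>})} = (\<Union>\<beta>\<in>{..<\<kappa>}. {..<trec z s Sup \<beta>})"
    using limit_pos[OF limit.hyps] by (auto simp: less_Sup_image_iff)
  moreover have "countable (\<Union>\<beta>\<in>{..<\<kappa>}. {..<trec z s Sup \<beta>})"
    using limit by (intro countable_UN) (auto simp flip: less_omega1_iff_countable)
  ultimately show ?case
    using limit.hyps by (simp add: trec_limit less_omega1_iff_countable)
qed (use assms in simp)

lemma opow_less_omega1:
  assumes "\<alpha> < \<omega>\<^sub>1"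
  shows "\<omega> ^\<^sub>o \<alpha> < \<omega>\<^sub>1"
proof -
  have zero: "0 < \<omega>\<^sub>1"
    by (simp add: less_omega1_iff_countable lessThan_def)
  have "{..<\<omega>} = range onat"
    using less_omega_iff by auto
  then have om: "\<omega> < \<omega>\<^sub>1"
    by (simp add: less_omega1_iff_countable)
  have plus: "\<beta> + \<gamma> < \<omega>\<^sub>1" if "\<beta> < \<omega>\<^sub>1" "\<gamma> < \<omega>\<^sub>1" for \<beta> \<gamma>
    using that by (auto simp: plus_ordinal_def intro: trec_less_omega1 osuc_less_omega1)
  have times: "\<beta> * \<gamma> < \<omega>\<^sub>1" if "\<beta> < \<omega>\<^sub>1" "\<gamma> < \<omega>\<^sub>1" for \<beta> \<gamma>
    using that zero by (auto simp: times_ordinal_def intro: trec_less_omega1 plus)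
  show ?thesis
    unfolding opow_def using assms om zero
    by (auto simp: one_ordinal_eq intro: trec_less_omega1 times osuc_less_omega1)
qed

lemma plus_less_omega1: "\<alpha> < \<omega>\<^sub>1 \<Longrightarrow> \<beta> < \<omega>\<^sub>1 \<Longrightarrow> \<alpha> + \<beta> < \<omega>\<^sub>1"
  by (auto simp: plus_ordinal_def intro: trec_less_omega1 osuc_less_omega1)

subsection \<open>The natural sum\<close>

text \<open>
  This is the Hessenberg sum, given by the recursion that makes it the least function that is strictly
  increasing in both arguments. Strictness in both arguments is what ordinary addition lacks, and it is
  what combining two ranks requires.
\<close>
function nsum :: "ordinal \<Rightarrow> ordinal \<Rightarrow> ordinal" where
  "nsum \<alpha> \<beta> = (LEAST \<gamma>. \<forall>\<delta> \<in> (\<lambda>\<alpha>'. nsum \<alpha>' \<beta>) ` {..<\<alpha>} \<union> (\<lambda>\<beta>'. nsum \<alpha> \<beta>') ` {..<\<beta>}. \<delta> < \<gamma>)"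
  by auto
termination
  by (relation "{(\<alpha>, \<beta>). \<alpha> < \<beta>} <*lex*> {(\<alpha>, \<beta>). \<alpha> < \<beta>}") (auto simp: wf)

declare nsum.simps [simp del]

lemma nsum_bounds: "\<forall>\<delta> \<in> (\<lambda>\<alpha>'. nsum \<alpha>' \<beta>) ` {..<\<alpha>} \<union> (\<lambda>\<beta>'. nsum \<alpha> \<beta>') ` {..<\<beta>}. \<delta> < nsum \<alpha> \<beta>"
proof -
  have "bdd_above ((\<lambda>\<alpha>'. nsum \<alpha>' \<beta>) ` {..<\<alpha>} \<union> (\<lambda>\<beta>'. nsum \<alpha> \<beta>') ` {..<\<beta>})"
    by (simp add: bdd_above_image_lessThan)
  then obtain \<gamma> where "\<forall>\<delta> \<in> (\<lambda>\<alpha>'. nsum \<alpha>' \<beta>) ` {..<\<alpha>} \<union> (\<lambda>\<beta>'. nsum \<alpha> \<beta>') ` {..<\<beta>}. \<delta> < osuc \<gamma>"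
    unfolding bdd_above_def less_osuc_iff by blast
  then show ?thesis
    by (subst (2) nsum.simps) (rule LeastI)
qed

lemma nsum_less1: "\<alpha>' < \<alpha> \<Longrightarrow> nsum \<alpha>' \<beta> < nsum \<alpha> \<beta>"
  and nsum_less2: "\<beta>' < \<beta> \<Longrightarrow> nsum \<alpha> \<beta>' < nsum \<alpha> \<beta>"
  using nsum_bounds[of \<beta> \<alpha>] by auto

lemma nsum_leI:
  assumes "\<And>\<alpha>'. \<alpha>' < \<alpha> \<Longrightarrow> nsum \<alpha>' \<beta> < \<gamma>" "\<And>\<beta>'. \<beta>' < \<beta> \<Longrightarrow> nsum \<alpha> \<beta>' < \<gamma>"
  shows "nsum \<alpha> \<beta> \<le> \<gamma>"
  by (subst nsum.simps) (rule Least_le, use assms in auto)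

lemma nsum_mono: "\<alpha>' \<le> \<alpha> \<Longrightarrow> \<beta>' \<le> \<beta> \<Longrightarrow> nsum \<alpha>' \<beta>' \<le> nsum \<alpha> \<beta>"
  by (metis le_less less_trans nsum_less1 nsum_less2)

lemma nsum_eqD:
  assumes "\<alpha>' \<le> \<alpha>" "\<beta>' \<le> \<beta>" "nsum \<alpha>' \<beta>' = nsum \<alpha> \<beta>"
  shows "\<alpha>' = \<alpha>" "\<beta>' = \<beta>"
  using assms by (metis le_less less_trans less_irrefl nsum_less1 nsum_less2)+

text \<open>
  Below \<open>\<theta> * \<omega>\<close> an ordinal is a pair of a natural multiple of \<open>\<theta>\<close> and a remainder, and the bound
  adds both components separately. It follows by induction on the two arguments, since making one of
  them smaller makes the right-hand side lexicographically smaller.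
\<close>
lemma nsum_multiples:
  assumes closed: "\<And>r s. r < \<theta> \<Longrightarrow> s < \<theta> \<Longrightarrow> nsum r s < \<theta>"
  assumes "r < \<theta>" "s < \<theta>"
  shows "nsum (\<theta> * onat m + r) (\<theta> * onat n + s) \<le> \<theta> * onat (m + n) + nsum r s"
proof -
  have onat_less: "onat k < onat l \<longleftrightarrow> k < l" for k l
    by (rule strict_mono_less) (simp add: strict_mono_Suc_iff)
  have onat_eq: "onat k = onat l \<longleftrightarrow> k = l" for k l
    by (rule strict_mono_eq) (simp add: strict_mono_Suc_iff)
  have \<theta>: "0 < \<theta>"
    using assms(2) by (rule le_less_trans[OF zero_le_ordinal])
  have lower: "\<exists>m' r'. \<alpha> = \<theta> * onat m' + r' \<and> r' < \<theta> \<and> (m' < m \<or> m' = m \<and> r' < r)"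
    if "\<alpha> < \<theta> * onat m + r" "r < \<theta>" for \<alpha> m r
  proof -
    obtain q r' where q: "\<alpha> = \<theta> * q + r'" "r' < \<theta>"
      using ordinal_division[OF \<theta>] by blast
    then have "q < onat m \<or> q = onat m \<and> r' < r"
      using that division_less_iff[of r' \<theta> r q "onat m"] by simp
    moreover have "onat m < \<omega>"
      by (simp add: less_omega_iff)
    ultimately have "q < \<omega>"
      by auto
    then obtain m' where "q = onat m'"
      by (auto simp: less_omega_iff)
    with \<open>q < onat m \<or> q = onat m \<and> r' < r\<close> show ?thesis
      using q onat_less[of m' m] onat_eq[of m' m] by blast
  qed
  have "nsum \<alpha> \<beta> \<le> \<theta> * onat (m + n) + nsum r s"
    if "\<alpha> = \<theta> * onat m + r" "\<beta> = \<theta> * onat n + s" "r < \<theta>" "s < \<theta>" for \<alpha> \<beta> m n r s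
    using that
  proof (induction \<alpha> \<beta> arbitrary: m r n s rule: nsum.induct)
    case (1 \<alpha> \<beta>)
    note IH1 = "1.IH"(1)[OF lessThan_iff[THEN iffD2]]
    note IH2 = "1.IH"(2)[OF lessThan_iff[THEN iffD2]]
    note eqs = "1.prems"(1,2) and rs = "1.prems"(3,4)
    show ?case
    proof (rule nsum_leI)
      fix \<alpha>' assume \<alpha>': "\<alpha>' < \<alpha>"
      obtain m' r' where *: "\<alpha>' = \<theta> * onat m' + r'" "r' < \<theta>" "m' < m \<or> m' = m \<and> r' < r"
        using lower[OF \<alpha>'[unfolded eqs(1)] rs(1)] by blast
      have "nsum \<alpha>' \<beta> \<le> \<theta> * onat (m' + n) + nsum r' s"
        using \<alpha>' *(1) eqs(2) *(2) rs(2) by (rule IH1)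
      also have "\<dots> < \<theta> * onat (m + n) + nsum r s"
        using *(3) closed[OF *(2) rs(2)] closed[OF rs] nsum_less1[of r' r s]
        by (subst division_less_iff) (auto simp: onat_less)
      finally show "nsum \<alpha>' \<beta> < \<theta> * onat (m + n) + nsum r s" .
    next
      fix \<beta>' assume \<beta>': "\<beta>' < \<beta>"
      obtain n' s' where *: "\<beta>' = \<theta> * onat n' + s'" "s' < \<theta>" "n' < n \<or> n' = n \<and> s' < s"
        using lower[OF \<beta>'[unfolded eqs(2)] rs(2)] by blast
      have "nsum \<alpha> \<beta>' \<le> \<theta> * onat (m + n') + nsum r s'"
        using \<beta>' eqs(1) *(1) rs(1) *(2) by (rule IH2)
      also have "\<dots> < \<theta> * onat (m + n) + nsum r s"
        using *(3) closed[OF rs(1) *(2)] closed[OF rs] nsum_less2[of s' s r]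
        by (subst division_less_iff) (auto simp: onat_less)
      finally show "nsum \<alpha> \<beta>' < \<theta> * onat (m + n) + nsum r s" .
    qed
  qed
  with assms show ?thesis
    by blast
qed

text \<open>
  Powers of \<open>\<omega>\<close> are closed under the natural sum; at a successor exponent \<open>nsum_multiples\<close> carries the
  induction over one factor \<open>\<omega>\<close>.
\<close>
lemma nsum_less_opow:
  assumes "\<alpha> < \<omega> ^\<^sub>o \<xi>" "\<beta> < \<omega> ^\<^sub>o \<xi>"
  shows "nsum \<alpha> \<beta> < \<omega> ^\<^sub>o \<xi>"
  using assms
proof (induction \<xi> arbitrary: \<alpha> \<beta> rule: ordinal_induct)
  case zero
  then have "\<alpha> = 0" "\<beta> = 0"
    by (auto simp: one_ordinal_eq less_osuc_iff antisym)
  moreover have "nsum 0 0 \<le> 0"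
    by (rule nsum_leI) simp_all
  ultimately show ?case
    by (simp add: one_ordinal_eq less_osuc_iff)
next
  case (osuc \<xi>)
  let ?\<theta> = "\<omega> ^\<^sub>o \<xi>"
  have div: "\<exists>m r. \<gamma> = ?\<theta> * onat m + r \<and> r < ?\<theta>" if "\<gamma> < ?\<theta> * \<omega>" for \<gamma>
  proof -
    obtain q r where q: "\<gamma> = ?\<theta> * q + r" "r < ?\<theta>"
      using ordinal_division[OF opow_pos] by blast
    have "q < \<omega>"
    proof (rule ccontr)
      assume "\<not> q < \<omega>"
      then have "?\<theta> * \<omega> \<le> ?\<theta> * q"
        by (simp add: normal_le_iff[OF normal_times[OF opow_pos]])
      then show False
        using that q le_plus by (metis leD order_trans)
    qed
    with q show ?thesis
      by (auto simp: less_omega_iff)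
  qed
  obtain m r n s where *: "\<alpha> = ?\<theta> * onat m + r" "r < ?\<theta>" "\<beta> = ?\<theta> * onat n + s" "s < ?\<theta>"
    using osuc.prems div unfolding opow_osuc by metis
  then have "nsum \<alpha> \<beta> \<le> ?\<theta> * onat (m + n) + nsum r s"
    using nsum_multiples osuc.IH by blast
  also have "\<dots> < ?\<theta> * \<omega>"
    using * osuc.IH by (intro division_less) (auto simp: less_omega_iff)
  finally show ?case
    by (simp add: opow_osuc)
next
  case (limit \<kappa>)
  then obtain \<delta> \<epsilon> where "\<delta> < \<kappa>" "\<alpha> < \<omega> ^\<^sub>o \<delta>" "\<epsilon> < \<kappa>" "\<beta> < \<omega> ^\<^sub>o \<epsilon>"
    using normal_less_limit_iff[OF normal_opow] by metis
  moreover from this have "\<alpha> < \<omega> ^\<^sub>o max \<delta> \<epsilon>" "\<beta> < \<omega> ^\<^sub>o max \<delta> \<epsilon>"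
    using normal_le_iff[OF normal_opow] by (metis less_le_trans max.cobounded1 max.cobounded2)+
  ultimately show ?case
    using limit normal_less_limit_iff[OF normal_opow] by (metis max_less_iff_conj)
qed

section \<open>The oscillation index through rank functions\<close>

text \<open>
  A rank is an upper semicontinuous ordinal function which controls a relation near each point on its
  level set. For the relation \<open>\<bar>f y - f z\<bar> < \<epsilon>\<close>, a rank with values below \<open>\<theta>\<close> exists exactly when the
  \<open>\<theta>\<close>-th oscillation set is empty, so bounds on oscillation indices become constructions of ranks. The
  relation is left general because a product is treated one term at a time.
\<close>
definition local_rank :: "'a::topological_space set \<Rightarrow> ('a \<Rightarrow> 'a \<Rightarrow> bool) \<Rightarrow> ('a \<Rightarrow> ordinal) \<Rightarrow> bool"
  where "local_rank K R \<rho> \<longleftrightarrow> (\<forall>x\<in>K. \<exists>U. open U \<and> x \<in> U \<and> (\<forall>y\<in>U \<inter> K. \<rho> y \<le> \<rho> x) \<and>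
    (\<forall>y\<in>U \<inter> K. \<forall>z\<in>U \<inter> K. \<rho> y = \<rho> x \<longrightarrow> \<rho> z = \<rho> x \<longrightarrow> R y z))"

lemma local_rankI:
  assumes "\<And>x. x \<in> K \<Longrightarrow> \<exists>U. open U \<and> x \<in> U \<and> (\<forall>y\<in>U \<inter> K. \<rho> y \<le> \<rho> x) \<and>
    (\<forall>y\<in>U \<inter> K. \<forall>z\<in>U \<inter> K. \<rho> y = \<rho> x \<longrightarrow> \<rho> z = \<rho> x \<longrightarrow> R y z)"
  shows "local_rank K R \<rho>"
  using assms by (simp add: local_rank_def)

lemma local_rankE:
  assumes "local_rank K R \<rho>" "x \<in> K"
  obtains U where "open U" "x \<in> U" "\<forall>y\<in>U \<inter> K. \<rho> y \<le> \<rho> x"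
    and "\<forall>y\<in>U \<inter> K. \<forall>z\<in>U \<inter> K. \<rho> y = \<rho> x \<longrightarrow> \<rho> z = \<rho> x \<longrightarrow> R y z"
  using assms unfolding local_rank_def by metis

lemma local_rank_mono:
  assumes "local_rank K R \<rho>" "\<And>y z. y \<in> K \<Longrightarrow> z \<in> K \<Longrightarrow> R y z \<Longrightarrow> S y z"
  shows "local_rank K S \<rho>"
  using assms unfolding local_rank_def by (meson IntD2)

text \<open>
  Near \<open>x\<close> neither rank exceeds its value at \<open>x\<close>, so by strictness the natural sum keeps its value only
  where both ranks do.
\<close>
lemma local_rank_nsum:
  assumes \<rho>: "local_rank K R \<rho>" and \<sigma>: "local_rank K S \<sigma>"
  shows "local_rank K (\<lambda>y z. R y z \<and> S y z) (\<lambda>x. nsum (\<rho> x) (\<sigma> x))"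
proof (rule local_rankI)
  fix x assume x: "x \<in> K"
  obtain U where U: "open U" "x \<in> U" "\<forall>y\<in>U \<inter> K. \<rho> y \<le> \<rho> x"
    "\<forall>y\<in>U \<inter> K. \<forall>z\<in>U \<inter> K. \<rho> y = \<rho> x \<longrightarrow> \<rho> z = \<rho> x \<longrightarrow> R y z"
    by (rule local_rankE[OF \<rho> x])
  obtain V where V: "open V" "x \<in> V" "\<forall>y\<in>V \<inter> K. \<sigma> y \<le> \<sigma> x"
    "\<forall>y\<in>V \<inter> K. \<forall>z\<in>V \<inter> K. \<sigma> y = \<sigma> x \<longrightarrow> \<sigma> z = \<sigma> x \<longrightarrow> S y z"
    by (rule local_rankE[OF \<sigma> x])
  have "\<rho> y = \<rho> x \<and> \<sigma> y = \<sigma> x" if "y \<in> U \<inter> V \<inter> K" "nsum (\<rho> y) (\<sigma> y) = nsum (\<rho> x) (\<sigma> x)" for y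
    using that U(3) V(3) nsum_eqD by blast
  with U V show "\<exists>W. open W \<and> x \<in> W \<and> (\<forall>y\<in>W \<inter> K. nsum (\<rho> y) (\<sigma> y) \<le> nsum (\<rho> x) (\<sigma> x)) \<and>
    (\<forall>y\<in>W \<inter> K. \<forall>z\<in>W \<inter> K. nsum (\<rho> y) (\<sigma> y) = nsum (\<rho> x) (\<sigma> x) \<longrightarrow>
      nsum (\<rho> z) (\<sigma> z) = nsum (\<rho> x) (\<sigma> x) \<longrightarrow> R y z \<and> S y z)"
    by (intro exI[of _ "U \<inter> V"] conjI ballI impI) (auto intro: nsum_mono)
qed

abbreviation osc_less :: "('a \<Rightarrow> real) \<Rightarrow> real \<Rightarrow> 'a \<Rightarrow> 'a \<Rightarrow> bool"
  where "osc_less f \<epsilon> y z \<equiv> \<bar>f y - f z\<bar> < \<epsilon>"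

lemma osc_set_zero: "osc_set K f \<epsilon> 0 = K"
  and osc_set_osuc: "osc_set K f \<epsilon> (osuc \<alpha>) = osc_derivative f \<epsilon> (osc_set K f \<epsilon> \<alpha>)"
  and osc_set_limit: "is_limit \<kappa> \<Longrightarrow> osc_set K f \<epsilon> \<kappa> = (\<Inter>\<alpha>\<in>{..<\<kappa>}. osc_set K f \<epsilon> \<alpha>)"
  by (simp_all add: osc_set_def trec_limit)

lemma osc_set_antimono: "\<alpha> \<le> \<beta> \<Longrightarrow> osc_set K f \<epsilon> \<beta> \<subseteq> osc_set K f \<epsilon> \<alpha>"
proof (induction \<beta> rule: ordinal_induct)
  case zero
  then have "\<alpha> = 0"
    by (simp add: antisym)
  then show ?case
    by simp
next
  case (osuc \<beta>)
  have "osc_set K f \<epsilon> (osuc \<beta>) \<subseteq> osc_set K f \<epsilon> \<beta>"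
    by (auto simp: osc_set_osuc osc_derivative_def)
  with osuc show ?case
    by (cases "\<alpha> = osuc \<beta>") (auto simp: le_less less_osuc_iff)
next
  case (limit \<kappa>)
  then show ?case
    by (cases "\<alpha> = \<kappa>") (auto simp: osc_set_limit)
qed

text \<open>
  If a point \<open>x\<close> of rank \<open>\<alpha>\<close> survived one more step, then near \<open>x\<close> all surviving points would have rank
  exactly \<open>\<alpha>\<close>, at least \<open>\<alpha>\<close> by induction and at most \<open>\<alpha>\<close> by semicontinuity. But on that level set \<open>f\<close>
  oscillates by less than \<open>\<epsilon>\<close>.
\<close>
lemma osc_set_subset_rank:
  assumes "local_rank K (osc_less f \<epsilon>) \<rho>" "x \<in> osc_set K f \<epsilon> \<alpha>"
  shows "\<alpha> \<le> \<rho> x"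
  using assms(2)
proof (induction \<alpha> arbitrary: x rule: ordinal_induct)
  case (osuc \<alpha>)
  then have x: "x \<in> osc_set K f \<epsilon> \<alpha>"
    and big: "\<And>U. open U \<Longrightarrow> x \<in> U \<Longrightarrow>
      \<exists>y\<in>U \<inter> osc_set K f \<epsilon> \<alpha>. \<exists>z\<in>U \<inter> osc_set K f \<epsilon> \<alpha>. \<not> osc_less f \<epsilon> y z"
    by (auto simp: osc_set_osuc osc_derivative_def not_less)
  have sub: "osc_set K f \<epsilon> \<alpha> \<subseteq> K"
    using osc_set_antimono[OF zero_le_ordinal] by (simp add: osc_set_zero)
  obtain U where U: "open U" "x \<in> U" "\<forall>y\<in>U \<inter> K. \<rho> y \<le> \<rho> x"
    "\<forall>y\<in>U \<inter> K. \<forall>z\<in>U \<inter> K. \<rho> y = \<rho> x \<longrightarrow> \<rho> z = \<rho> x \<longrightarrow> osc_less f \<epsilon> y z"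
    by (rule local_rankE[OF assms(1) subsetD[OF sub x]])
  obtain y z where yz: "y \<in> U" "y \<in> osc_set K f \<epsilon> \<alpha>" "z \<in> U" "z \<in> osc_set K f \<epsilon> \<alpha>"
    "\<not> osc_less f \<epsilon> y z"
    using big[OF U(1,2)] by blast
  have "\<alpha> \<noteq> \<rho> x"
  proof
    assume eq: "\<alpha> = \<rho> x"
    have "\<rho> y = \<rho> x" "\<rho> z = \<rho> x"
      using osuc.IH[OF yz(2)] osuc.IH[OF yz(4)] U(3) yz sub eq by (meson IntI antisym subsetD)+
    then show False
      using U(4) yz sub by blast
  qed
  with osuc.IH[OF x] show ?case
    by (simp add: osuc_le_iff)
next
  case (limit \<kappa>)
  then have "\<beta> \<le> \<rho> x" if "\<beta> < \<kappa>" for \<beta>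
    using that by (auto simp: osc_set_limit)
  with limit.hyps show ?case
    by (meson leD limit_osuc_less leI osuc_le_iff)
qed simp

lemma osc_set_empty_if_rank:
  assumes "local_rank K (osc_less f \<epsilon>) \<rho>" "\<And>x. x \<in> K \<Longrightarrow> \<rho> x < \<theta>"
  shows "osc_set K f \<epsilon> \<theta> = {}"
  using osc_set_subset_rank[OF assms(1)] assms(2) osc_set_antimono[OF zero_le_ordinal, of K f \<epsilon> \<theta>]
  by (fastforce simp: osc_set_zero)

text \<open>
  The stage at which a point drops out of the oscillation sets. It is the least rank, and its value is
  meaningful only if the point drops out at all.
\<close>
definition osc_rank :: "'a::metric_space set \<Rightarrow> ('a \<Rightarrow> real) \<Rightarrow> real \<Rightarrow> 'a \<Rightarrow> ordinal"
  where "osc_rank K f \<epsilon> x = (LEAST \<alpha>. x \<notin> osc_set K f \<epsilon> (osuc \<alpha>))"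

lemma in_osc_set_osc_rank:
  assumes "x \<in> K"
  shows "x \<in> osc_set K f \<epsilon> (osc_rank K f \<epsilon> x)"
proof -
  have "x \<in> osc_set K f \<epsilon> \<alpha>" if "\<alpha> \<le> osc_rank K f \<epsilon> x" for \<alpha>
    using that
  proof (induction \<alpha> rule: ordinal_induct)
    case (osuc \<alpha>)
    then show ?case
      unfolding osc_rank_def osuc_le_iff by (blast dest: not_less_Least)
  next
    case (limit \<kappa>)
    then show ?case
      by (auto simp: osc_set_limit)
  qed (simp add: assms osc_set_zero)
  then show ?thesis
    by simp
qed

lemma
  assumes empty: "osc_set K f \<epsilon> \<theta> = {}"
  shows local_rank_osc_rank: "local_rank K (osc_less f \<epsilon>) (osc_rank K f \<epsilon>)"
    and osc_rank_less: "x \<in> K \<Longrightarrow> osc_rank K f \<epsilon> x < \<theta>"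
proof -
  have "x \<notin> osc_set K f \<epsilon> (osuc \<theta>)" for x
    using osc_set_antimono[of \<theta> "osuc \<theta>" K f \<epsilon>] empty by (auto simp: less_imp_le)
  then have notin: "x \<notin> osc_set K f \<epsilon> (osuc (osc_rank K f \<epsilon> x))" for x
    unfolding osc_rank_def by (rule LeastI)
  show "osc_rank K f \<epsilon> x < \<theta>" if "x \<in> K" for x
    using in_osc_set_osc_rank[OF that, of f \<epsilon>] empty osc_set_antimono[of \<theta> _ K f \<epsilon>]
    by (metis empty_iff linorder_not_le subsetD)
  show "local_rank K (osc_less f \<epsilon>) (osc_rank K f \<epsilon>)"
  proof (rule local_rankI)
    fix x assume x: "x \<in> K"
    let ?r = "osc_rank K f \<epsilon>" and ?A = "osc_set K f \<epsilon> (osc_rank K f \<epsilon> x)"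
    obtain U where U: "open U" "x \<in> U" "\<And>y z. y \<in> U \<inter> ?A \<Longrightarrow> z \<in> U \<inter> ?A \<Longrightarrow> osc_less f \<epsilon> y z"
      using notin[of x] in_osc_set_osc_rank[OF x, of f \<epsilon>]
      unfolding osc_set_osuc osc_derivative_def by (auto simp: not_le)
    have le: "?r y \<le> ?r x" if "y \<in> U" for y
    proof -
      have "y \<notin> osc_derivative f \<epsilon> ?A"
        using U that unfolding osc_derivative_def by (auto simp: not_le[symmetric])
      then show ?thesis
        unfolding osc_set_osuc[symmetric] osc_rank_def[of K f \<epsilon> y] by (rule Least_le)
    qed
    have level: "y \<in> ?A" if "y \<in> K" "?r y = ?r x" for y
      using that in_osc_set_osc_rank[of y K f \<epsilon>] by simp
    show "\<exists>U. open U \<and> x \<in> U \<and> (\<forall>y\<in>U \<inter> K. ?r y \<le> ?r x) \<and>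
      (\<forall>y\<in>U \<inter> K. \<forall>z\<in>U \<inter> K. ?r y = ?r x \<longrightarrow> ?r z = ?r x \<longrightarrow> osc_less f \<epsilon> y z)"
      by (intro exI[of _ U] conjI ballI impI U le) (auto intro: U level)
  qed
qed

text \<open>
  A rank for the finer scale is also one for the coarser scale, where the oscillation rank is minimal.
\<close>
lemma osc_rank_antimono:
  assumes "osc_set K f \<delta> \<theta> = {}" "\<delta> \<le> \<epsilon>" "x \<in> K"
  shows "osc_rank K f \<epsilon> x \<le> osc_rank K f \<delta> x"
proof -
  have "local_rank K (osc_less f \<epsilon>) (osc_rank K f \<delta>)"
    by (rule local_rank_mono[OF local_rank_osc_rank[OF assms(1)]]) (use assms(2) in auto)
  then show ?thesis
    using in_osc_set_osc_rank[OF assms(3)] by (rule osc_set_subset_rank)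
qed

lemma osc_index_eps_le_iff:
  assumes "\<theta> < \<omega>\<^sub>1"
  shows "osc_index_eps K f \<epsilon> \<le> \<theta> \<longleftrightarrow> osc_set K f \<epsilon> \<theta> = {}"
proof
  assume le: "osc_index_eps K f \<epsilon> \<le> \<theta>"
  have ex: "\<exists>\<alpha><\<omega>\<^sub>1. osc_set K f \<epsilon> \<alpha> = {}"
  proof (rule ccontr)
    assume "\<not> ?thesis"
    with le have "\<omega>\<^sub>1 \<le> \<theta>"
      by (simp only: osc_index_eps_def if_False)
    with assms show False
      by simp
  qed
  then obtain \<alpha> where "osc_set K f \<epsilon> \<alpha> = {}"
    by blast
  then have "osc_set K f \<epsilon> (LEAST \<alpha>. osc_set K f \<epsilon> \<alpha> = {}) = {}"
    by (rule LeastI)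
  then have "osc_set K f \<epsilon> (osc_index_eps K f \<epsilon>) = {}"
    using ex by (simp only: osc_index_eps_def if_True)
  then show "osc_set K f \<epsilon> \<theta> = {}"
    using osc_set_antimono[OF le, of K f \<epsilon>] by simp
next
  assume empty: "osc_set K f \<epsilon> \<theta> = {}"
  with assms have "osc_index_eps K f \<epsilon> = (LEAST \<alpha>. osc_set K f \<epsilon> \<alpha> = {})"
    unfolding osc_index_eps_def by (intro if_P) blast
  also have "\<dots> \<le> \<theta>"
    using empty by (rule Least_le)
  finally show "osc_index_eps K f \<epsilon> \<le> \<theta>" .
qed

lemma osc_index_le_iff:
  assumes "\<theta> < \<omega>\<^sub>1"
  shows "osc_index K f \<le> \<theta> \<longleftrightarrow> (\<forall>\<epsilon>>0. osc_set K f \<epsilon> \<theta> = {})"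
proof -
  have "bdd_above (osc_index_eps K f ` {0<..})"
    by (rule bdd_aboveI[of _ "\<omega>\<^sub>1"]) (auto simp: osc_index_eps_le_omega1)
  moreover have "{0::real<..} \<noteq> {}"
    by (auto intro: gt_ex)
  ultimately have "osc_index K f \<le> \<theta> \<longleftrightarrow> (\<forall>\<epsilon>\<in>{0<..}. osc_index_eps K f \<epsilon> \<le> \<theta>)"
    unfolding osc_index_def by (intro cSUP_le_iff)
  then show ?thesis
    unfolding osc_index_eps_le_iff[OF assms] Ball_def greaterThan_iff .
qed

section \<open>The upper bound\<close>

text \<open>
  This is the source of the ordinal product. The oscillation rank \<open>a\<close> of \<open>f\<close> at scale 1 cuts \<open>K\<close> into layers
  on which \<open>f\<close> is locally bounded. Near a point of a layer with bound \<open>M\<close>, the rank \<open>b\<close> of \<open>g\<close> at scale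
  \<open>\<epsilon> / (M + 1)\<close> controls the term \<open>\<bar>f y\<bar> * \<bar>g y - g z\<bar>\<close>. The scale depends on the point, but all these
  ranks lie below \<open>\<theta>\<close>, so \<open>\<theta> * a + b\<close> orders the points first by layer and then by \<open>b\<close>.
\<close>
lemma product_rank:
  fixes f g :: "'a::metric_space \<Rightarrow> real"
  assumes f: "osc_set K f 1 \<phi> = {}" and g: "\<And>\<epsilon>. 0 < \<epsilon> \<Longrightarrow> osc_set K g \<epsilon> \<theta> = {}" and "0 < \<epsilon>"
  shows "\<exists>\<rho>. local_rank K (\<lambda>y z. \<bar>f y\<bar> * \<bar>g y - g z\<bar> < \<epsilon>) \<rho> \<and> (\<forall>x\<in>K. \<rho> x < \<theta> * \<phi>)"
proof -
  define a where "a = osc_rank K f 1"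
  define bound where "bound x n \<longleftrightarrow> (\<exists>U. open U \<and> x \<in> U \<and> (\<forall>y\<in>U \<inter> K. a y = a x \<longrightarrow> \<bar>f y\<bar> \<le> real n))"
    for x n
  \<comment> \<open>The least bound is upper semicontinuous on a layer, so the scale \<open>\<delta>\<close> gets no finer near a point.\<close>
  define M where "M x = (LEAST n. bound x n)" for x
  define \<delta> where "\<delta> x = \<epsilon> / (real (M x) + 1)" for x
  define b where "b x = osc_rank K g (\<delta> x) x" for x
  define \<rho> where "\<rho> x = \<theta> * a x + b x" for x
  have a_rank: "local_rank K (osc_less f 1) a"
    unfolding a_def using f by (rule local_rank_osc_rank)
  have \<delta>: "0 < \<delta> x" for x
    using \<open>0 < \<epsilon>\<close> by (simp add: \<delta>_def add_nonneg_pos)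
  have b: "b x < \<theta>" if "x \<in> K" for x
    unfolding b_def using g[OF \<delta>] that by (rule osc_rank_less)
  have bound_M: "bound x (M x)" if x: "x \<in> K" for x
    unfolding M_def
  proof (rule LeastI)
    obtain U where U: "open U" "x \<in> U" "\<forall>y\<in>U \<inter> K. a y \<le> a x"
      "\<forall>y\<in>U \<inter> K. \<forall>z\<in>U \<inter> K. a y = a x \<longrightarrow> a z = a x \<longrightarrow> osc_less f 1 y z"
      by (rule local_rankE[OF a_rank x])
    have "\<bar>f y\<bar> \<le> real (nat \<lceil>\<bar>f x\<bar> + 1\<rceil>)" if y: "y \<in> U \<inter> K" "a y = a x" for y
    proof -
      have "osc_less f 1 y x"
        using U(2,4) x y by blast
      then have "\<bar>f y\<bar> \<le> \<bar>f x\<bar> + 1"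
        by linarith
      then show ?thesis
        using real_nat_ceiling_ge by (rule order_trans)
    qed
    then show "bound x (nat \<lceil>\<bar>f x\<bar> + 1\<rceil>)"
      unfolding bound_def by (intro exI[of _ U] conjI ballI impI U)
  qed
  have "local_rank K (\<lambda>y z. \<bar>f y\<bar> * \<bar>g y - g z\<bar> < \<epsilon>) \<rho>"
  proof (rule local_rankI)
    fix x assume x: "x \<in> K"
    let ?b = "osc_rank K g (\<delta> x)"
    obtain U where U: "open U" "x \<in> U" "\<forall>y\<in>U \<inter> K. a y \<le> a x"
      by (rule local_rankE[OF a_rank x])
    obtain V where V: "open V" "x \<in> V" "\<And>y. y \<in> V \<Longrightarrow> y \<in> K \<Longrightarrow> a y = a x \<Longrightarrow> \<bar>f y\<bar> \<le> real (M x)"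
      using bound_M[OF x] unfolding bound_def by auto
    obtain W where W: "open W" "x \<in> W" "\<forall>y\<in>W \<inter> K. ?b y \<le> ?b x"
      "\<forall>y\<in>W \<inter> K. \<forall>z\<in>W \<inter> K. ?b y = ?b x \<longrightarrow> ?b z = ?b x \<longrightarrow> osc_less g (\<delta> x) y z"
      by (rule local_rankE[OF local_rank_osc_rank[OF g[OF \<delta>]] x])
    \<comment> \<open>\<open>b y\<close> is computed at the scale of \<open>y\<close>, which is at least as coarse as that of \<open>x\<close>.\<close>
    have b_le: "b y \<le> ?b y" if "y \<in> V" "y \<in> K" "a y = a x" for y
    proof -
      have "bound y (M x)"
        unfolding bound_def using V that by auto
      then have "M y \<le> M x"
        unfolding M_def[of y] by (rule Least_le)
      then have "\<delta> x \<le> \<delta> y"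
        using \<open>0 < \<epsilon>\<close> unfolding \<delta>_def by (intro divide_left_mono) auto
      then show ?thesis
        unfolding b_def using that(2) by (rule osc_rank_antimono[OF g[OF \<delta>]])
    qed
    have bx: "?b x = b x"
      by (simp add: b_def)
    have le: "\<rho> y \<le> \<rho> x" if y: "y \<in> U \<inter> V \<inter> W" "y \<in> K" for y
    proof (cases "a y = a x")
      case True
      then have "b y \<le> b x"
        using b_le[of y] W(3) y bx by (metis IntD1 IntD2 IntI order_trans)
      with True show ?thesis
        by (simp add: \<rho>_def plus_le_cancel)
    next
      case False
      then have "a y < a x"
        using U(3) y by (meson IntD1 IntI le_neq_trans)
      then have "\<rho> y < \<rho> x"
        unfolding \<rho>_def by (simp add: division_less_iff b x y)
      then show ?thesis
        by simp
    qed
    have level: "a y = a x \<and> ?b y = ?b x" if y: "y \<in> U \<inter> V \<inter> W" "y \<in> K" "\<rho> y = \<rho> x" for y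
    proof -
      have "\<not> a y < a x"
        using y(3) division_less_iff[OF b b, of y x "a y" "a x"] x y(2) unfolding \<rho>_def by auto
      then have ay: "a y = a x"
        using U(3) y by (meson IntD1 IntI le_neq_trans)
      have "b y = b x"
        using y(3) ay plus_le_cancel[of "\<theta> * a x"] unfolding \<rho>_def by (metis antisym order_refl)
      then show ?thesis
        using ay b_le[of y] W(3) y bx by (metis IntD1 IntD2 IntI antisym)
    qed
    have "\<bar>f y\<bar> * \<bar>g y - g z\<bar> < \<epsilon>"
      if yz: "y \<in> (U \<inter> V \<inter> W) \<inter> K" "z \<in> (U \<inter> V \<inter> W) \<inter> K" "\<rho> y = \<rho> x" "\<rho> z = \<rho> x" for y z
    proof -
      have "\<bar>f y\<bar> \<le> real (M x)" "osc_less g (\<delta> x) y z"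
        using V(3)[of y] W(4) level[of y] level[of z] yz by auto
      then have "\<bar>f y\<bar> * \<bar>g y - g z\<bar> \<le> (real (M x) + 1) * \<bar>g y - g z\<bar>"
        by (intro mult_right_mono) auto
      also have "\<dots> < (real (M x) + 1) * \<delta> x"
        using \<open>osc_less g (\<delta> x) y z\<close> by (intro mult_strict_left_mono) auto
      also have "\<dots> = \<epsilon>"
        by (simp add: \<delta>_def add_nonneg_eq_0_iff)
      finally show ?thesis .
    qed
    with le U V W show "\<exists>U. open U \<and> x \<in> U \<and> (\<forall>y\<in>U \<inter> K. \<rho> y \<le> \<rho> x) \<and>
      (\<forall>y\<in>U \<inter> K. \<forall>z\<in>U \<inter> K. \<rho> y = \<rho> x \<longrightarrow> \<rho> z = \<rho> x \<longrightarrow> \<bar>f y\<bar> * \<bar>g y - g z\<bar> < \<epsilon>)"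
      by (intro exI[of _ "U \<inter> V \<inter> W"]) auto
  qed
  moreover have "\<rho> x < \<theta> * \<phi>" if "x \<in> K" for x
    unfolding \<rho>_def a_def by (rule division_less[OF b[OF that] osc_rank_less[OF f that]])
  ultimately show ?thesis
    by blast
qed

lemma osc_set_baire1_class:
  assumes "f \<in> baire1_class \<xi> K" "\<xi> < \<omega>\<^sub>1" "0 < \<epsilon>"
  shows "osc_set K f \<epsilon> (\<omega> ^\<^sub>o \<xi>) = {}"
proof -
  have "osc_index K f \<le> \<omega> ^\<^sub>o \<xi>"
    using assms(1) unfolding baire1_class_def by blast
  with assms(3) show ?thesis
    unfolding osc_index_le_iff[OF opow_less_omega1[OF assms(2)]] by blast
qed

text \<open>
  The oscillation of \<open>f * g\<close> splits into a term that sees the oscillation of \<open>g\<close> against the size of \<open>f\<close> and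
  one with the roles exchanged. Each has a rank by \<open>product_rank\<close>, below \<open>\<omega>\<close> to the powers \<open>\<xi>2 + \<xi>1\<close> and
  \<open>\<xi>1 + \<xi>2\<close>, and the natural sum of the two ranks stays below the larger power.
\<close>
theorem osc_index_product_le:
  assumes f: "f \<in> baire1_class \<xi>1 K" and g: "g \<in> baire1_class \<xi>2 K"
    and \<xi>: "\<xi>1 < \<omega>\<^sub>1" "\<xi>2 < \<omega>\<^sub>1"
  shows "osc_index K (\<lambda>x. f x * g x) \<le> \<omega> ^\<^sub>o max (\<xi>1 + \<xi>2) (\<xi>2 + \<xi>1)"
proof -
  let ?\<theta> = "\<omega> ^\<^sub>o max (\<xi>1 + \<xi>2) (\<xi>2 + \<xi>1)"
  have "osc_set K (\<lambda>x. f x * g x) \<epsilon> ?\<theta> = {}" if "0 < \<epsilon>" for \<epsilon>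
  proof -
    obtain \<rho> where \<rho>: "local_rank K (\<lambda>y z. \<bar>f y\<bar> * \<bar>g y - g z\<bar> < \<epsilon> / 2) \<rho>"
      "\<forall>x\<in>K. \<rho> x < \<omega> ^\<^sub>o \<xi>2 * \<omega> ^\<^sub>o \<xi>1"
      using product_rank[OF osc_set_baire1_class[OF f \<xi>(1) zero_less_one]
          osc_set_baire1_class[OF g \<xi>(2)], of "\<epsilon> / 2"] \<open>0 < \<epsilon>\<close> by auto
    obtain \<sigma> where \<sigma>: "local_rank K (\<lambda>y z. \<bar>g y\<bar> * \<bar>f y - f z\<bar> < \<epsilon> / 2) \<sigma>"
      "\<forall>x\<in>K. \<sigma> x < \<omega> ^\<^sub>o \<xi>1 * \<omega> ^\<^sub>o \<xi>2"
      using product_rank[OF osc_set_baire1_class[OF g \<xi>(2) zero_less_one]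
          osc_set_baire1_class[OF f \<xi>(1)], of "\<epsilon> / 2"] \<open>0 < \<epsilon>\<close> by auto
    have "local_rank K (\<lambda>z y. \<bar>f z\<bar> * \<bar>g z - g y\<bar> < \<epsilon> / 2 \<and> \<bar>g y\<bar> * \<bar>f y - f z\<bar> < \<epsilon> / 2)
        (\<lambda>x. nsum (\<rho> x) (\<sigma> x))"
    proof (rule local_rank_nsum[OF \<rho>(1)])
      \<comment> \<open>Exchanging \<open>y\<close> and \<open>z\<close> here makes both terms refer to one decomposition of the difference.\<close>
      show "local_rank K (\<lambda>z y. \<bar>g y\<bar> * \<bar>f y - f z\<bar> < \<epsilon> / 2) \<sigma>"
        using \<sigma>(1) unfolding local_rank_def by metis
    qed
    then have "local_rank K (osc_less (\<lambda>x. f x * g x) \<epsilon>) (\<lambda>x. nsum (\<rho> x) (\<sigma> x))"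
    proof (rule local_rank_mono)
      fix z y
      assume *: "\<bar>f z\<bar> * \<bar>g z - g y\<bar> < \<epsilon> / 2 \<and> \<bar>g y\<bar> * \<bar>f y - f z\<bar> < \<epsilon> / 2"
      have "f z * g z - f y * g y = f z * (g z - g y) - g y * (f y - f z)"
        by (simp add: algebra_simps)
      also have "\<bar>\<dots>\<bar> \<le> \<bar>f z\<bar> * \<bar>g z - g y\<bar> + \<bar>g y\<bar> * \<bar>f y - f z\<bar>"
        by (metis abs_mult abs_triangle_ineq4)
      finally show "osc_less (\<lambda>x. f x * g x) \<epsilon> z y"
        using * by linarith
    qed
    moreover have "nsum (\<rho> x) (\<sigma> x) < ?\<theta>" if "x \<in> K" for x
    proof (rule nsum_less_opow)
      have le: "\<omega> ^\<^sub>o (\<xi>2 + \<xi>1) \<le> ?\<theta>" "\<omega> ^\<^sub>o (\<xi>1 + \<xi>2) \<le> ?\<theta>"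
        by (simp_all add: normal_le_iff[OF normal_opow])
      show "\<rho> x < ?\<theta>" "\<sigma> x < ?\<theta>"
        using \<rho>(2) \<sigma>(2) le that by (auto simp: opow_plus)
    qed
    ultimately show ?thesis
      by (rule osc_set_empty_if_rank)
  qed
  moreover have "?\<theta> < \<omega>\<^sub>1"
    using \<xi> by (intro opow_less_omega1) (simp add: plus_less_omega1)
  ultimately show ?thesis
    by (simp add: osc_index_le_iff)
qed

section \<open>Layered subsets of spaces of large Cantor--Bendixson rank\<close>

lemma derived_set_zero: "derived_set K 0 = K"
  and derived_set_osuc: "derived_set K (osuc \<alpha>) = {x. x islimpt derived_set K \<alpha>}"
  and derived_set_limit: "is_limit \<kappa> \<Longrightarrow> derived_set K \<kappa> = (\<Inter>\<alpha>\<in>{..<\<kappa>}. derived_set K \<alpha>)"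
  by (simp_all add: derived_set_def trec_limit)

lemma closed_derived_set:
  assumes "closed K"
  shows "closed (derived_set K \<alpha>)"
  by (induction \<alpha> rule: ordinal_induct)
    (auto simp: assms derived_set_zero derived_set_osuc derived_set_limit closed_limpts)

lemma derived_set_antimono:
  assumes "closed K"
  shows "\<alpha> \<le> \<beta> \<Longrightarrow> derived_set K \<beta> \<subseteq> derived_set K \<alpha>"
proof (induction \<beta> rule: ordinal_induct)
  case zero
  then have "\<alpha> = 0"
    by (simp add: antisym)
  then show ?case
    by simp
next
  case (osuc \<beta>)
  have "derived_set K (osuc \<beta>) \<subseteq> derived_set K \<beta>"
    using closed_derived_set[OF assms, of \<beta>] by (auto simp: derived_set_osuc closed_limpt)
  with osuc show ?case
    by (cases "\<alpha> = osuc \<beta>") (auto simp: le_less less_osuc_iff)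
next
  case (limit \<kappa>)
  then show ?case
    by (cases "\<alpha> = \<kappa>") (auto simp: derived_set_limit)
qed

lemma islimpt_derived_set:
  assumes "closed K" "x \<in> derived_set K \<theta>" "\<beta> < \<theta>"
  shows "x islimpt derived_set K \<beta>"
  using assms derived_set_antimono[of K "osuc \<beta>" \<theta>] by (auto simp: osuc_le_iff derived_set_osuc)

text \<open>
  Points are chosen so rapidly convergent that the ball of radius one third of the distance to \<open>x\<close> around
  each of them lies in its own annulus around \<open>x\<close>, and the annuli are disjoint.
\<close>
lemma limit_point_sequence:
  fixes x :: "'a::metric_space"
  assumes "\<And>n. x islimpt S n" "0 < e"
  shows "\<exists>y. \<forall>n. (y n \<in> S n \<and> y n \<noteq> x \<and> dist (y n) x < e / real (Suc n)) \<and>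
    dist (y (Suc n)) x \<le> dist (y n) x / 4"
proof (rule dependent_nat_choice)
  show "\<exists>y. y \<in> S 0 \<and> y \<noteq> x \<and> dist y x < e / real (Suc 0)"
    using assms by (auto simp: islimpt_approachable)
  fix y n
  assume "y \<in> S n \<and> y \<noteq> x \<and> dist y x < e / real (Suc n)"
  then have "0 < min (e / real (Suc (Suc n))) (dist y x / 4)"
    using assms(2) by simp
  then obtain z where "z \<in> S (Suc n)" "z \<noteq> x" "dist z x < min (e / real (Suc (Suc n))) (dist y x / 4)"
    using assms(1)[of "Suc n"] unfolding islimpt_approachable by blast
  then show "\<exists>z. (z \<in> S (Suc n) \<and> z \<noteq> x \<and> dist z x < e / real (Suc (Suc n))) \<and> dist z x \<le> dist y x / 4"
    by (intro exI[of _ z]) auto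
qed

lemma enumerate_infinitely_often:
  assumes "countable S" "S \<noteq> {}"
  obtains c :: "nat \<Rightarrow> 'a" where "\<And>n. c n \<in> S" "\<And>s k. s \<in> S \<Longrightarrow> \<exists>n\<ge>k. c n = s"
proof
  let ?c = "\<lambda>n. from_nat_into S (fst (prod_decode n))"
  show "?c n \<in> S" for n
    using assms(2) by (rule from_nat_into)
  fix s k assume s: "s \<in> S"
  have "?c (prod_encode (to_nat_on S s, k)) = s"
    using assms(1) s by simp
  then show "\<exists>n\<ge>k. ?c n = s"
    using le_prod_encode_2 by blast
qed

text \<open>
  A label carries an ordinal height, a size and a colour. The witnesses for the lower bound have absolute
  values governed by the size; the colour is what the product \<open>f * g\<close> shows.
\<close>
type_synonym label = "ordinal \<times> nat \<times> bool"

abbreviation height :: "label \<Rightarrow> ordinal" where "height l \<equiv> fst l"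
abbreviation size_of :: "label \<Rightarrow> nat" where "size_of l \<equiv> fst (snd l)"
abbreviation colour :: "label \<Rightarrow> bool" where "colour l \<equiv> snd (snd l)"

text \<open>
  This relates the label of a point to those of nearby points. The function \<open>q\<close> groups heights into
  layers: within a layer the size is constant, and points of a lower layer have sizes beyond any \<open>N\<close>
  prescribed by the neighbourhood.
\<close>
definition below :: "(ordinal \<Rightarrow> ordinal) \<Rightarrow> nat \<Rightarrow> label \<Rightarrow> label \<Rightarrow> bool"
  where "below q N l l' \<longleftrightarrow> height l' < height l \<and>
    (if q (height l') = q (height l) then size_of l' = size_of l
     else N \<le> size_of l' \<and> size_of l \<le> size_of l')"

lemma below_trans:
  assumes "mono q" "below q N l l'" "below q N l' l''"
  shows "below q N l l''"
proof -
  have "q (height l'') \<le> q (height l')" "q (height l') \<le> q (height l)"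
    using assms by (auto simp: below_def intro: monoD)
  with assms(2,3) show ?thesis
    unfolding below_def by (auto split: if_splits)
qed

lemma below_antimono: "below q N l l' \<Longrightarrow> M \<le> N \<Longrightarrow> below q M l l'"
  by (auto simp: below_def split: if_splits)

text \<open>
  The first condition says that around \<open>y\<close> the heights drop strictly while the sizes in lower layers tend
  to infinity. The second one provides, arbitrarily close to \<open>y\<close> and for every smaller height, points that
  are at least as high and have the other colour.
\<close>
definition layered_at :: "(ordinal \<Rightarrow> ordinal) \<Rightarrow> 'a::metric_space set \<Rightarrow> ('a \<Rightarrow> label) \<Rightarrow> 'a \<Rightarrow> bool"
  where "layered_at q L lab y \<longleftrightarrow>
    (\<forall>N. \<exists>d>0. \<forall>z\<in>L. z \<noteq> y \<longrightarrow> dist z y < d \<longrightarrow> below q N (lab y) (lab z)) \<and>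
    (\<forall>\<beta><height (lab y). \<forall>d>0. \<exists>z\<in>L. dist z y < d \<and> \<beta> \<le> height (lab z) \<and> colour (lab z) \<noteq> colour (lab y))"

text \<open>
  The condition is local, which allows layered sets to be glued along separated balls.
\<close>
lemma layered_at_cong:
  assumes lay: "layered_at q A lab y" and "y \<in> A" "0 < r"
    and eq: "\<And>z. dist z y < r \<Longrightarrow> z \<in> A \<longleftrightarrow> z \<in> B" "\<And>z. z \<in> A \<Longrightarrow> lab z = lab' z"
  shows "layered_at q B lab' y"
  unfolding layered_at_def
proof (intro conjI allI impI)
  fix N
  obtain d where d: "0 < d" "\<forall>z\<in>A. z \<noteq> y \<longrightarrow> dist z y < d \<longrightarrow> below q N (lab y) (lab z)"
    using lay unfolding layered_at_def by blast
  have "below q N (lab' y) (lab' z)" if z: "z \<in> B" "z \<noteq> y" "dist z y < min d r" for z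
  proof -
    have "z \<in> A"
      using eq(1)[of z] z by simp
    then show ?thesis
      using d(2) z eq(2) \<open>y \<in> A\<close> by (metis min_less_iff_conj)
  qed
  then show "\<exists>d>0. \<forall>z\<in>B. z \<noteq> y \<longrightarrow> dist z y < d \<longrightarrow> below q N (lab' y) (lab' z)"
    using d(1) \<open>0 < r\<close> by (intro exI[of _ "min d r"]) simp
next
  fix \<beta> and d :: real
  assume "\<beta> < height (lab' y)" "0 < d"
  then have "\<beta> < height (lab y)" "0 < min d r"
    using eq(2)[OF assms(2)] assms(3) by auto
  then obtain z where "z \<in> A" "dist z y < min d r" "\<beta> \<le> height (lab z)" "colour (lab z) \<noteq> colour (lab y)"
    using lay unfolding layered_at_def by blast
  then show "\<exists>z\<in>B. dist z y < d \<and> \<beta> \<le> height (lab' z) \<and> colour (lab' z) \<noteq> colour (lab' y)"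
    using eq assms(2) by (intro bexI[of _ z]) auto
qed

definition layered :: "(ordinal \<Rightarrow> ordinal) \<Rightarrow> 'a::metric_space set \<Rightarrow> ('a \<Rightarrow> label) \<Rightarrow> bool"
  where "layered q L lab \<longleftrightarrow> (\<forall>y\<in>L. layered_at q L lab y)"

definition layered_root ::
  "(ordinal \<Rightarrow> ordinal) \<Rightarrow> nat \<Rightarrow> label \<Rightarrow> 'a::metric_space \<Rightarrow> 'a set \<Rightarrow> ('a \<Rightarrow> label) \<Rightarrow> bool"
  where "layered_root q N l x L lab \<longleftrightarrow> x \<in> L \<and> closed L \<and> countable L \<and> lab x = l \<and> layered q L lab \<and>
    (\<forall>z\<in>L. z \<noteq> x \<longrightarrow> below q N l (lab z))"

text \<open>
  The induction on \<open>\<theta>\<close> builds a tree with root \<open>x\<close>. As \<open>x\<close> is a limit point of all smaller derived sets,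
  there are points \<open>y n\<close> converging to \<open>x\<close> such that every height below \<open>\<theta>\<close> is assigned to infinitely many
  of them. Small layered sets around the \<open>y n\<close>, of the opposite colour at \<open>y n\<close> and with sizes at least
  \<open>N + n\<close> unless the layer is that of \<open>x\<close>, are glued together with \<open>x\<close>.
\<close>
lemma layered_root_exists:
  fixes K :: "'a::metric_space set"
  assumes "closed K" "mono q"
  shows "\<theta> < \<omega>\<^sub>1 \<Longrightarrow> x \<in> derived_set K \<theta> \<Longrightarrow> 0 < e \<Longrightarrow>
    \<exists>L lab. L \<subseteq> K \<inter> cball x e \<and> layered_root q N (\<theta>, m, p) x L lab"
proof (induction \<theta> arbitrary: x e N m p rule: less_induct)
  case (less \<theta>)
  have xK: "x \<in> K"
    using derived_set_antimono[OF assms(1) zero_le_ordinal] less.prems(2) by (auto simp: derived_set_zero)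
  show ?case
  proof (cases "\<theta> = 0")
    case True
    then have "layered_root q N (\<theta>, m, p) x {x} (\<lambda>_. (\<theta>, m, p))"
      by (auto simp: layered_root_def layered_def layered_at_def intro: exI[of _ 1])
    moreover have "{x} \<subseteq> K \<inter> cball x e"
      using xK less.prems(3) by simp
    ultimately show ?thesis
      by blast
  next
    case False
    then have "{..<\<theta>} \<noteq> {}" "countable {..<\<theta>}"
      using less.prems(1) by (auto simp: less_omega1_iff_countable simp flip: zero_less_iff)
    then obtain c :: "nat \<Rightarrow> ordinal" where c: "\<And>n. c n < \<theta>" "\<And>\<beta> k. \<beta> < \<theta> \<Longrightarrow> \<exists>n\<ge>k. c n = \<beta>"
      using enumerate_infinitely_often[of "{..<\<theta>}"] by (metis lessThan_iff)
    obtain y where y: "\<And>n. y n \<in> derived_set K (c n)" "\<And>n. y n \<noteq> x"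
        "\<And>n. dist (y n) x < e / 2 / real (Suc n)" "\<And>n. dist (y (Suc n)) x \<le> dist (y n) x / 4"
      using limit_point_sequence[of x "\<lambda>n. derived_set K (c n)" "e / 2"]
        islimpt_derived_set[OF assms(1) less.prems(2) c(1)] less.prems(3) by auto
    define d where "d n = dist (y n) x" for n
    have d_pos: "0 < d n" for n
      using y(2) by (simp add: d_def)
    have d_less: "d n < e / 2 / real (Suc n)" for n
      using y(3) by (simp add: d_def)
    have d_e: "d n < e / 2" for n
    proof -
      have "e / 2 / real (Suc n) \<le> e / 2"
        using less.prems(3) by (simp add: field_simps)
      then show ?thesis
        by (rule less_le_trans[OF d_less])
    qed
    \<comment> \<open>Distances decay by a factor 4, whence the annuli \<open>[2/3 * d n, 4/3 * d n]\<close> are disjoint.\<close>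
    have d_Suc: "d k \<le> d n / 4" if "n < k" for n k
      using that
    proof (induction k)
      case (Suc k)
      have "d (Suc k) \<le> d k / 4"
        using y(4) by (simp add: d_def)
      moreover have "d k \<le> d n" if "n \<noteq> k"
        using Suc.IH Suc.prems that d_pos[of n] by simp
      ultimately show ?case
        by (cases "n = k") auto
    qed simp
    define m' where "m' n = (if q (c n) = q \<theta> then m else N + n + m)" for n
    define l where "l n = (c n, m' n, \<not> p)" for n
    have "\<forall>n. \<exists>L lab. L \<subseteq> K \<inter> cball (y n) (d n / 3) \<and> layered_root q (N + n) (l n) (y n) L lab"
      unfolding l_def using d_pos less.prems(1) c(1) y(1)
      by (intro allI less.IH) (auto intro: less_trans)
    then obtain Ls labs where Ls: "\<And>n. Ls n \<subseteq> K \<inter> cball (y n) (d n / 3)"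
        "\<And>n. layered_root q (N + n) (l n) (y n) (Ls n) (labs n)"
      by metis
    have inner: "2 / 3 * d n \<le> dist z x" and outer: "dist z x \<le> 4 / 3 * d n" if "z \<in> Ls n" for z n
    proof -
      have "dist (y n) z \<le> d n / 3"
        using subsetD[OF Ls(1) that] by simp
      then show "2 / 3 * d n \<le> dist z x" "dist z x \<le> 4 / 3 * d n"
        using dist_triangle[of "y n" x z] dist_triangle[of z x "y n"]
        by (auto simp: d_def dist_commute)
    qed
    have sep: "d n / 3 \<le> dist w z" if "z \<in> Ls n" "w \<in> Ls k" "n \<noteq> k" for z w n k
    proof (cases "n < k")
      case True
      then show ?thesis
        using inner[OF that(1)] outer[OF that(2)] d_Suc[of n k] dist_triangle[of z x w]
        by (simp add: dist_commute)
    next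
      case False
      then show ?thesis
        using outer[OF that(1)] inner[OF that(2)] d_Suc[of k n] that(3) d_pos[of n] dist_triangle[of w x z]
        by simp
    qed
    have disj: "n = k" if "z \<in> Ls n" "z \<in> Ls k" for z n k
      using sep[OF that] d_pos[of n] by (cases "n = k") auto
    have x_notin: "x \<notin> Ls n" for n
      using inner[of x n] d_pos[of n] by auto
    define L where "L = insert x (\<Union>n. Ls n)"
    define lab where "lab z = (if z = x then (\<theta>, m, p) else labs (THE n. z \<in> Ls n) z)" for z
    have lab_x: "lab x = (\<theta>, m, p)"
      by (simp add: lab_def)
    have lab: "lab z = labs n z" if "z \<in> Ls n" for z n
    proof -
      have "(THE k. z \<in> Ls k) = n"
        using that disj by blast
      then show ?thesis
        using that x_notin by (auto simp: lab_def)
    qed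
    have yL: "y n \<in> Ls n" and lab_y: "lab (y n) = l n" for n
      using Ls(2)[of n] lab[of "y n" n] by (auto simp: layered_root_def)
    have below: "below q (N + n) (\<theta>, m, p) (lab z)" if "z \<in> Ls n" for z n
    proof -
      have *: "below q (N + n) (\<theta>, m, p) (l n)"
        using c(1) by (simp add: below_def l_def m'_def)
      show ?thesis
      proof (cases "z = y n")
        case True
        with * lab_y show ?thesis
          by simp
      next
        case False
        then have "below q (N + n) (l n) (lab z)"
          using Ls(2)[of n] that lab by (simp add: layered_root_def)
        with * show ?thesis
          by (rule below_trans[OF assms(2)])
      qed
    qed
    have "layered_at q L lab z" if z: "z \<in> Ls n" for z n
    proof (rule layered_at_cong)
      show "layered_at q (Ls n) (labs n) z"
        using Ls(2)[of n] z by (simp add: layered_root_def layered_def)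
      show "0 < d n / 3"
        using d_pos by simp
      show "w \<in> Ls n \<longleftrightarrow> w \<in> L" if "dist w z < d n / 3" for w
      proof -
        have "w \<noteq> x"
          using that inner[OF z] d_pos[of n] by (auto simp: dist_commute)
        moreover have "k = n" if "w \<in> Ls k" for k
          using sep[OF z that] \<open>dist w z < d n / 3\<close> by auto
        ultimately show ?thesis
          by (auto simp: L_def)
      qed
    qed (use z lab in auto)
    moreover have "layered_at q L lab x"
      unfolding layered_at_def
    proof (intro conjI allI impI)
      fix M
      have "below q M (lab x) (lab z)" if z: "z \<in> L" "z \<noteq> x" "dist z x < 2 / 3 * d M" for z
      proof -
        obtain n where n: "z \<in> Ls n"
          using z(1,2) by (auto simp: L_def)
        have "\<not> n < M"
          using inner[OF n] d_Suc[of n M] z(3) d_pos[of n] by auto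
        with below[OF n] show ?thesis
          unfolding lab_x by (auto intro: below_antimono)
      qed
      then show "\<exists>r>0. \<forall>z\<in>L. z \<noteq> x \<longrightarrow> dist z x < r \<longrightarrow> below q M (lab x) (lab z)"
        using d_pos by (intro exI[of _ "2 / 3 * d M"]) simp
    next
      fix \<beta> and r :: real
      assume "\<beta> < height (lab x)" "0 < r"
      then have "\<beta> < \<theta>"
        by (simp add: lab_x)
      obtain k :: nat where k: "e / 2 / r < real k"
        using reals_Archimedean2 by blast
      obtain n where n: "n \<ge> k" "c n = \<beta>"
        using c(2)[OF \<open>\<beta> < \<theta>\<close>] by blast
      have "e / 2 / r < real (Suc n)"
        using k n(1) by simp
      then have "e / 2 / real (Suc n) < r"
        using \<open>0 < r\<close> by (simp add: field_simps)
      then have "dist (y n) x < r"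
        using y(3)[of n] by simp
      moreover have "y n \<in> L"
        using yL by (auto simp: L_def)
      ultimately show "\<exists>z\<in>L. dist z x < r \<and> \<beta> \<le> height (lab z) \<and> colour (lab z) \<noteq> colour (lab x)"
        using n(2) by (intro bexI[of _ "y n"]) (auto simp: lab_y l_def lab_x)
    qed
    ultimately have "layered q L lab"
      by (auto simp: layered_def L_def)
    moreover have "closed L"
    proof -
      \<comment> \<open>Only finitely many pieces leave a given ball around \<open>x\<close>.\<close>
      have "L = (\<Inter>M. cball x (4 / 3 * d M) \<union> (\<Union>n\<in>{..<M}. Ls n))"
      proof (intro equalityI subsetI)
        fix z assume "z \<in> L"
        show "z \<in> (\<Inter>M. cball x (4 / 3 * d M) \<union> (\<Union>n\<in>{..<M}. Ls n))"
        proof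
          fix M
          show "z \<in> cball x (4 / 3 * d M) \<union> (\<Union>n\<in>{..<M}. Ls n)"
          proof (cases "z = x")
            case True
            then show ?thesis
              using d_pos[of M] by simp
          next
            case False
            then obtain n where n: "z \<in> Ls n"
              using \<open>z \<in> L\<close> by (auto simp: L_def)
            show ?thesis
            proof (cases "n < M")
              case True
              with n show ?thesis
                by auto
            next
              case False
              then have "d n \<le> d M"
                using d_Suc[of M n] d_pos[of M] by (cases "n = M") auto
              then show ?thesis
                using outer[OF n] by (simp add: dist_commute)
            qed
          qed
        qed
      next
        fix z assume z: "z \<in> (\<Inter>M. cball x (4 / 3 * d M) \<union> (\<Union>n\<in>{..<M}. Ls n))"
        show "z \<in> L"
        proof (cases "z = x")
          case False
          obtain k :: nat where k: "e / dist z x < real k"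
            using reals_Archimedean2 by blast
          then have "e / dist z x < real (Suc k)"
            by simp
          then have "e / real (Suc k) < dist z x"
            using False by (simp add: field_simps)
          moreover have "2 * d k < e / real (Suc k)"
            using d_less[of k] by (simp add: field_simps)
          ultimately have "4 / 3 * d k < dist z x"
            using d_pos[of k] by linarith
          then have "z \<notin> cball x (4 / 3 * d k)"
            by (simp add: dist_commute)
          with z show ?thesis
            by (auto simp: L_def)
        qed (simp add: L_def)
      qed
      moreover have "closed (cball x (4 / 3 * d M) \<union> (\<Union>n\<in>{..<M}. Ls n))" for M
        using Ls(2) by (intro closed_Un closed_cball closed_UN) (auto simp: layered_root_def)
      ultimately show ?thesis
        by (simp add: closed_INT)
    qed
    moreover have "countable L"
      using Ls(2) by (auto simp: L_def layered_root_def)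
    moreover have "below q N (\<theta>, m, p) (lab z)" if z: "z \<in> L" "z \<noteq> x" for z
    proof -
      obtain n where "z \<in> Ls n"
        using z by (auto simp: L_def)
      from below_antimono[OF below[OF this]] show ?thesis
        by simp
    qed
    moreover have "L \<subseteq> K \<inter> cball x e"
    proof -
      have "Ls n \<subseteq> cball x e" for n
      proof
        fix z assume "z \<in> Ls n"
        from outer[OF this] show "z \<in> cball x e"
          using d_e[of n] d_pos[of n] by (simp add: dist_commute)
      qed
      then show ?thesis
        using Ls(1) xK less.prems(3) by (auto simp: L_def)
    qed
    ultimately show ?thesis
      using lab_x by (intro exI[of _ L] exI[of _ lab]) (auto simp: layered_root_def L_def)
  qed
qed

text \<open>
  The \<open>n\<close>-th approximation is a sum of tents over the first \<open>n\<close> points of \<open>L\<close>. Their radius \<open>1 / k n\<close> is at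
  most the distance of any two of these points, so that the values there are exact, and tends to 0, so
  that a point off the closed set \<open>L\<close> is eventually missed by all tents.
\<close>
lemma baire1_countable_closed_support:
  fixes f :: "'a::metric_space \<Rightarrow> real"
  assumes L: "closed L" "countable L" and zero: "\<And>x. x \<notin> L \<Longrightarrow> f x = 0"
  shows "f \<in> baire1 K"
proof -
  define A where "A n = from_nat_into L ` {..<n} \<inter> L" for n
  define k where "k n = real n + (\<Sum>y\<in>A n. \<Sum>z\<in>A n. inverse (dist y z))" for n
  define F where "F n x = (\<Sum>y\<in>A n. f y * max 0 (1 - k n * dist x y))" for n x
  have fin: "finite (A n)" for n
    by (simp add: A_def)
  have k1: "real n \<le> k n" for n
    by (simp add: k_def sum_nonneg)
  have k2: "1 \<le> k n * dist y z" if "y \<in> A n" "z \<in> A n" "y \<noteq> z" for n y z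
  proof -
    have "inverse (dist y z) \<le> (\<Sum>z\<in>A n. inverse (dist y z))"
      using fin that by (intro member_le_sum) auto
    also have "\<dots> \<le> (\<Sum>y\<in>A n. \<Sum>z\<in>A n. inverse (dist y z))"
      using fin that by (intro member_le_sum[of y _ "\<lambda>y. \<Sum>z\<in>A n. inverse (dist y z)"]) (auto intro: sum_nonneg)
    also have "\<dots> \<le> k n"
      by (simp add: k_def)
    finally show ?thesis
      using that(3) by (simp add: field_simps)
  qed
  have "continuous_on K (F n)" for n
    unfolding F_def by (intro continuous_intros)
  moreover have "(\<lambda>n. F n x) \<longlonglongrightarrow> f x" for x
  proof (rule tendsto_eventually)
    show "\<forall>\<^sub>F n in sequentially. F n x = f x"
    proof (cases "x \<in> L")
      case True
      have "F n x = f x" if "n > to_nat_on L x" for n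
      proof -
        have xA: "x \<in> A n"
          unfolding A_def using that True L(2) by (auto intro!: image_eqI[of _ _ "to_nat_on L x"])
        have "F n x = (\<Sum>y\<in>A n. if y = x then f x else 0)"
          unfolding F_def
        proof (rule sum.cong)
          fix y assume "y \<in> A n"
          then show "f y * max 0 (1 - k n * dist x y) = (if y = x then f x else 0)"
            using k2[OF xA, of y] by auto
        qed simp
        also have "\<dots> = f x"
          using fin xA by simp
        finally show ?thesis .
      qed
      then show ?thesis
        using eventually_gt_at_top by (rule eventually_mono[rotated])
    next
      case False
      then obtain d where d: "0 < d" "ball x d \<subseteq> - L"
        using L(1) by (meson ComplI open_Compl open_contains_ball)
      obtain N :: nat where N: "1 / d < real N"
        using reals_Archimedean2 by blast
      have "F n x = 0" if "n \<ge> N" for n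
        unfolding F_def
      proof (rule sum.neutral, rule ballI)
        fix y assume "y \<in> A n"
        then have "d \<le> dist x y"
          using d(2) by (auto simp: A_def not_less[symmetric])
        moreover have "1 / d \<le> k n"
          using N that k1[of n] by simp
        ultimately have "1 / d * d \<le> k n * dist x y"
          using d(1) k1[of n] by (intro mult_mono) auto
        then show "f y * max 0 (1 - k n * dist x y) = 0"
          using d(1) by simp
      qed
      then show ?thesis
        unfolding zero[OF False] using eventually_ge_at_top by (rule eventually_mono[rotated])
    qed
  qed
  ultimately show ?thesis
    by (auto simp: baire1_def)
qed

section \<open>The lower bound\<close>

lemma layered_root_height_le:
  assumes "layered_root q N l x L lab" "z \<in> L"
  shows "height (lab z) \<le> height l"
  using assms unfolding layered_root_def below_def by (cases "z = x") (auto intro: less_imp_le)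

text \<open>
  A point of height above \<open>\<alpha>\<close> has points of height at least \<open>\<alpha>\<close> and of the other colour arbitrarily
  close to it. By induction these are still present at stage \<open>\<alpha>\<close>, so the point survives that stage.
\<close>
lemma osc_set_layered:
  fixes L :: "'a::metric_space set"
  assumes L: "layered q L lab" "L \<subseteq> K"
    and h: "\<And>z. h z = (if z \<in> L \<and> colour (lab z) then 1 else 0)"
  shows "z \<in> L \<Longrightarrow> \<alpha> \<le> height (lab z) \<Longrightarrow> z \<in> osc_set K h 1 \<alpha>"
proof (induction \<alpha> arbitrary: z rule: ordinal_induct)
  case zero
  then show ?case
    using L(2) by (auto simp: osc_set_zero)
next
  case (osuc \<alpha>)
  then have \<alpha>: "\<alpha> < height (lab z)"
    by (simp add: osuc_le_iff)
  have z: "z \<in> osc_set K h 1 \<alpha>"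
    using osuc.IH[OF osuc.prems(1)] \<alpha> by simp
  have "\<exists>u\<in>U \<inter> osc_set K h 1 \<alpha>. \<exists>v\<in>U \<inter> osc_set K h 1 \<alpha>. 1 \<le> \<bar>h u - h v\<bar>"
    if U: "open U" "z \<in> U" for U
  proof -
    obtain d where d: "0 < d" "ball z d \<subseteq> U"
      using U open_contains_ball by blast
    obtain w where w: "w \<in> L" "dist w z < d" "\<alpha> \<le> height (lab w)" "colour (lab w) \<noteq> colour (lab z)"
      using L(1) osuc.prems(1) \<alpha> d(1) unfolding layered_def layered_at_def by blast
    have "w \<in> U \<inter> osc_set K h 1 \<alpha>"
      using osuc.IH[OF w(1,3)] w(2) d(2) by (auto simp: dist_commute)
    moreover have "1 \<le> \<bar>h z - h w\<bar>"
      using w(1,4) osuc.prems(1) by (auto simp: h)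
    ultimately show ?thesis
      using U z by blast
  qed
  then show ?case
    using z by (auto simp: osc_set_osuc osc_derivative_def)
next
  case (limit \<kappa>)
  then show ?case
    by (auto simp: osc_set_limit)
qed

lemma osc_index_layered:
  fixes L :: "'a::metric_space set"
  assumes "layered_root q N (\<theta>, m, p) x L lab" "L \<subseteq> K" "\<theta> < \<omega>\<^sub>1"
    and "\<And>z. h z = (if z \<in> L \<and> colour (lab z) then 1 else 0)"
  shows "\<theta> < osc_index K h"
proof -
  have "x \<in> osc_set K h 1 \<theta>"
    using assms by (intro osc_set_layered[of q L lab]) (auto simp: layered_root_def)
  then have "\<not> osc_index K h \<le> \<theta>"
    unfolding osc_index_le_iff[OF assms(3)] by (metis empty_iff zero_less_one)
  then show ?thesis
    by simp
qed

lemma layered_neighbourhood: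
  assumes "layered q L lab" "x \<in> L"
  shows "\<exists>U. open U \<and> x \<in> U \<and> (\<forall>z\<in>U \<inter> L. z = x \<or> below q N (lab x) (lab z))"
proof -
  obtain d where "0 < d" "\<forall>z\<in>L. z \<noteq> x \<longrightarrow> dist z x < d \<longrightarrow> below q N (lab x) (lab z)"
    using assms unfolding layered_def layered_at_def by blast
  then show ?thesis
    by (intro exI[of _ "ball x d"]) (auto simp: dist_commute)
qed

text \<open>
  Off the closed set \<open>L\<close> there is nothing to do, and near a point of \<open>L\<close> every other point of \<open>L\<close> has a
  label below, for any choice of \<open>N\<close>.
\<close>
lemma local_rank_layered:
  assumes L: "closed L" "layered q L lab"
    and off: "\<And>y z. y \<notin> L \<Longrightarrow> z \<notin> L \<Longrightarrow> R y z" "\<And>x. x \<notin> L \<Longrightarrow> \<rho> x = 0"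
    and on: "\<And>x z. x \<in> L \<Longrightarrow> z \<in> L \<Longrightarrow> below q N (lab x) (lab z) \<Longrightarrow> \<rho> z \<le> \<rho> x"
    and level: "\<And>x y z. x \<in> L \<Longrightarrow> \<forall>u\<in>{y, z}. \<rho> u = \<rho> x \<and> (u \<in> L \<longrightarrow> u = x \<or> below q N (lab x) (lab u)) \<Longrightarrow> R y z"
  shows "local_rank K R \<rho>"
proof (rule local_rankI)
  fix x assume "x \<in> K"
  show "\<exists>U. open U \<and> x \<in> U \<and> (\<forall>y\<in>U \<inter> K. \<rho> y \<le> \<rho> x) \<and>
    (\<forall>y\<in>U \<inter> K. \<forall>z\<in>U \<inter> K. \<rho> y = \<rho> x \<longrightarrow> \<rho> z = \<rho> x \<longrightarrow> R y z)"
  proof (cases "x \<in> L")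
    case True
    obtain U where U: "open U" "x \<in> U" "\<forall>z\<in>U \<inter> L. z = x \<or> below q N (lab x) (lab z)"
      using layered_neighbourhood[OF L(2) True] by blast
    have "\<rho> y \<le> \<rho> x" if "y \<in> U" for y
    proof (cases "y \<in> L")
      case y: True
      then have "y = x \<or> below q N (lab x) (lab y)"
        using U(3) that by blast
      then show ?thesis
        using on[OF True y] by auto
    qed (simp add: off(2))
    moreover have "R y z" if "y \<in> U" "z \<in> U" "\<rho> y = \<rho> x" "\<rho> z = \<rho> x" for y z
      using that U(3) by (intro level[OF True]) auto
    ultimately show ?thesis
      using U(1,2) by (intro exI[of _ U]) auto
  next
    case False
    then show ?thesis
      using L(1) off by (intro exI[of _ "- L"]) auto
  qed
qed

lemma baire1_classI:
  assumes "f \<in> baire1 K" "\<xi> < \<omega>\<^sub>1"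
    and "\<And>\<epsilon>. 0 < \<epsilon> \<Longrightarrow> \<exists>\<rho>. local_rank K (osc_less f \<epsilon>) \<rho> \<and> (\<forall>x\<in>K. \<rho> x < \<omega> ^\<^sub>o \<xi>)"
  shows "f \<in> baire1_class \<xi> K"
proof -
  have "osc_set K f \<epsilon> (\<omega> ^\<^sub>o \<xi>) = {}" if "0 < \<epsilon>" for \<epsilon>
    using assms(3)[OF that] osc_set_empty_if_rank by metis
  then have "osc_index K f \<le> \<omega> ^\<^sub>o \<xi>"
    unfolding osc_index_le_iff[OF opow_less_omega1[OF assms(2)]] by blast
  with assms(1) show ?thesis
    unfolding baire1_class_def by blast
qed

lemma const_baire1_class:
  assumes "\<xi> < \<omega>\<^sub>1"
  shows "(\<lambda>_. c) \<in> baire1_class \<xi> K"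
proof (rule baire1_classI)
  show "(\<lambda>_. c) \<in> baire1 K"
    unfolding baire1_def by (auto intro!: exI[of _ "\<lambda>_ _. c"])
  show "\<exists>\<rho>. local_rank K (osc_less (\<lambda>_. c) \<epsilon>) \<rho> \<and> (\<forall>x\<in>K. \<rho> x < \<omega> ^\<^sub>o \<xi>)" if "0 < \<epsilon>" for \<epsilon>
    using that opow_pos by (intro exI[of _ "\<lambda>_. 0"]) (auto simp: local_rank_def intro: exI[of _ UNIV])
qed (rule assms)

text \<open>
  If one of the exponents is 0, one of the two factors is continuous and can be taken constant. The colour of
  a layered set is then a sufficient witness, its rank being the height shifted by one to leave 0 for the
  points off the set.
\<close>
lemma single_witness:
  fixes K :: "'a::metric_space set"
  assumes "closed K" "\<xi> < \<omega>\<^sub>1" "\<theta> < \<omega> ^\<^sub>o \<xi>" "x \<in> derived_set K \<theta>"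
  shows "\<exists>h\<in>baire1_class \<xi> K. \<theta> < osc_index K h"
proof (cases "\<theta> = 0")
  case True
  then have "x \<in> osc_set K (\<lambda>_. 1) 1 0"
    using assms(4) by (simp add: osc_set_zero derived_set_zero)
  then have "\<not> osc_index K (\<lambda>_. 1) \<le> 0"
    using osc_index_le_iff[of 0 K "\<lambda>_. 1"] by (metis empty_iff zero_less_one assms(2) zero_le_ordinal le_less_trans)
  then show ?thesis
    using True const_baire1_class[OF assms(2)] by (metis not_le)
next
  case False
  \<comment> \<open>For \<open>\<xi> = 0\<close> only continuous functions are allowed, which is why height 0 is treated separately.\<close>
  have "0 < \<xi>"
    using assms(3) False by (auto simp: zero_less_iff one_ordinal_eq less_osuc_iff antisym)
  have \<theta>: "\<theta> < \<omega>\<^sub>1"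
    using assms(3) opow_less_omega1[OF assms(2)] by (rule less_trans)
  have mono: "mono (id :: ordinal \<Rightarrow> ordinal)"
    by (simp add: mono_def)
  obtain L lab where L: "L \<subseteq> K" "layered_root id 0 (\<theta>, 0, True) x L lab"
    using layered_root_exists[OF assms(1) mono \<theta> assms(4) zero_less_one, of 0 0 True] by blast
  then have lay: "closed L" "countable L" "layered id L lab"
    by (simp_all add: layered_root_def)
  have root: "height (lab z) \<le> \<theta>" if "z \<in> L" for z
    using layered_root_height_le[OF L(2) that] by simp
  define h where "h z = (if z \<in> L \<and> colour (lab z) then 1 else 0 :: real)" for z
  define \<rho> where "\<rho> z = (if z \<in> L then osuc (height (lab z)) else 0)" for z
  have "h \<in> baire1_class \<xi> K"
  proof (rule baire1_classI)
    show "h \<in> baire1 K"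
      using lay(1,2) by (rule baire1_countable_closed_support) (simp add: h_def)
    fix \<epsilon> :: real assume "0 < \<epsilon>"
    have "local_rank K (osc_less h \<epsilon>) \<rho>"
    proof (rule local_rank_layered[OF lay(1,3)])
      fix x y z
      assume "x \<in> L" and *: "\<forall>u\<in>{y, z}. \<rho> u = \<rho> x \<and> (u \<in> L \<longrightarrow> u = x \<or> below id 0 (lab x) (lab u))"
      then have "u = x" if "u \<in> {y, z}" for u
        using that by (auto simp: \<rho>_def below_def split: if_splits)
      from this[of y] this[of z] show "osc_less h \<epsilon> y z"
        using \<open>0 < \<epsilon>\<close> by simp
    qed (use \<open>0 < \<epsilon>\<close> in \<open>auto simp: h_def \<rho>_def below_def osuc_le_iff less_osuc_iff\<close>)
    moreover have "\<rho> z < \<omega> ^\<^sub>o \<xi>" for z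
    proof (cases "z \<in> L")
      case True
      then have "osuc (height (lab z)) < \<omega> ^\<^sub>o \<xi>"
        using root assms(3) \<open>0 < \<xi>\<close> by (intro limit_osuc_less limit_opow) (auto intro: le_less_trans)
      with True show ?thesis
        by (simp add: \<rho>_def)
    qed (simp add: \<rho>_def opow_pos)
    ultimately show "\<exists>\<rho>. local_rank K (osc_less h \<epsilon>) \<rho> \<and> (\<forall>x\<in>K. \<rho> x < \<omega> ^\<^sub>o \<xi>)"
      by blast
  qed (rule assms)
  moreover have "\<theta> < osc_index K h"
    using osc_index_layered[OF L(2,1) \<theta>] h_def by blast
  ultimately show ?thesis
    by blast
qed

text \<open>
  Write \<open>W\<close> for \<open>\<omega> ^\<^sub>o \<xi>2\<close> and divide heights by \<open>W\<close>, with layers given by the quotient. On a layered set put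
  \<open>f = size + 1\<close>, and \<open>g = 1 / (size + 1)\<close> or 0 according to the colour, so that \<open>f * g\<close> is the colour. The
  function \<open>f\<close> is locally constant on layers, so the quotient ranks it. At scale \<open>\<epsilon>\<close> the function \<open>g\<close> only
  sees points of size below some \<open>N\<close>; near such a point all the others of this kind belong to the same
  layer, so the remainder ranks \<open>g\<close>.
\<close>
lemma product_witness_pos:
  fixes K :: "'a::metric_space set"
  assumes "closed K" and \<xi>: "\<xi>1 < \<omega>\<^sub>1" "\<xi>2 < \<omega>\<^sub>1" "0 < \<xi>1" "0 < \<xi>2"
    and \<theta>: "\<theta> < \<omega> ^\<^sub>o \<xi>2 * \<omega> ^\<^sub>o \<xi>1" and x: "x \<in> derived_set K \<theta>"
  shows "\<exists>f\<in>baire1_class \<xi>1 K. \<exists>g\<in>baire1_class \<xi>2 K. \<theta> < osc_index K (\<lambda>x. f x * g x)"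
proof -
  let ?W = "\<omega> ^\<^sub>o \<xi>2"
  have "\<forall>\<alpha>. \<exists>q r. \<alpha> = ?W * q + r \<and> r < ?W"
    using ordinal_division[OF opow_pos] by metis
  then obtain q r where qr: "\<And>\<alpha>. \<alpha> = ?W * q \<alpha> + r \<alpha>" "\<And>\<alpha>. r \<alpha> < ?W"
    by metis
  have less_iff: "\<alpha> < \<beta> \<longleftrightarrow> q \<alpha> < q \<beta> \<or> q \<alpha> = q \<beta> \<and> r \<alpha> < r \<beta>" for \<alpha> \<beta>
    using division_less_iff[OF qr(2)[of \<alpha>] qr(2)[of \<beta>], of "q \<alpha>" "q \<beta>"] by (simp flip: qr(1))
  then have "mono q"
    by (intro monoI) (metis le_less)
  have "\<theta> < \<omega> ^\<^sub>o (\<xi>2 + \<xi>1)"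
    using \<theta> by (simp add: opow_plus)
  then have \<theta>1: "\<theta> < \<omega>\<^sub>1"
    using \<xi> by (meson less_trans opow_less_omega1 plus_less_omega1)
  obtain L lab where L: "L \<subseteq> K" "layered_root q 0 (\<theta>, 0, True) x L lab"
    using layered_root_exists[OF assms(1) \<open>mono q\<close> \<theta>1 x zero_less_one, of 0 0 True] by blast
  then have lay: "closed L" "countable L" "layered q L lab"
    by (simp_all add: layered_root_def)
  have root: "height (lab z) \<le> \<theta>" if "z \<in> L" for z
    using layered_root_height_le[OF L(2) that] by simp
  have q_less: "q (height (lab z)) < \<omega> ^\<^sub>o \<xi>1" if "z \<in> L" for z
  proof -
    have "?W * q (height (lab z)) \<le> height (lab z)"
      using le_plus qr(1) by metis
    also have "\<dots> < ?W * \<omega> ^\<^sub>o \<xi>1"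
      using root[OF that] \<theta> by (rule le_less_trans)
    finally show ?thesis
      by (simp add: normal_less_iff[OF normal_times[OF opow_pos]])
  qed
  define f where "f z = (if z \<in> L then real (Suc (size_of (lab z))) else 0)" for z
  define g where "g z = (if z \<in> L \<and> colour (lab z) then 1 / real (Suc (size_of (lab z))) else 0)" for z
  have "f \<in> baire1_class \<xi>1 K"
  proof (rule baire1_classI)
    show "f \<in> baire1 K"
      using lay(1,2) by (rule baire1_countable_closed_support) (simp add: f_def)
    fix \<epsilon> :: real assume "0 < \<epsilon>"
    define \<rho> where "\<rho> z = (if z \<in> L then osuc (q (height (lab z))) else 0)" for z
    have "local_rank K (osc_less f \<epsilon>) \<rho>"
    proof (rule local_rank_layered[OF lay(1,3)])
      show "\<rho> z \<le> \<rho> x" if "x \<in> L" "z \<in> L" "below q 0 (lab x) (lab z)" for x z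
        using that monoD[OF \<open>mono q\<close>, of "height (lab z)" "height (lab x)"]
        by (auto simp: \<rho>_def below_def osuc_le_iff less_osuc_iff)
      fix x y z
      assume "x \<in> L" and *: "\<forall>u\<in>{y, z}. \<rho> u = \<rho> x \<and> (u \<in> L \<longrightarrow> u = x \<or> below q 0 (lab x) (lab u))"
      have "f u = f x" if "u \<in> {y, z}" for u
        using \<open>x \<in> L\<close> * that by (auto simp: f_def \<rho>_def below_def split: if_splits)
      from this[of y] this[of z] show "osc_less f \<epsilon> y z"
        using \<open>0 < \<epsilon>\<close> by simp
    qed (use \<open>0 < \<epsilon>\<close> in \<open>auto simp: f_def \<rho>_def\<close>)
    moreover have "\<rho> z < \<omega> ^\<^sub>o \<xi>1" for z
      using limit_osuc_less[OF limit_opow[OF \<xi>(3)] q_less] opow_pos by (simp add: \<rho>_def)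
    ultimately show "\<exists>\<rho>. local_rank K (osc_less f \<epsilon>) \<rho> \<and> (\<forall>x\<in>K. \<rho> x < \<omega> ^\<^sub>o \<xi>1)"
      by blast
  qed (rule \<xi>)
  moreover have "g \<in> baire1_class \<xi>2 K"
  proof (rule baire1_classI)
    show "g \<in> baire1 K"
      using lay(1,2) by (rule baire1_countable_closed_support) (simp add: g_def)
    fix \<epsilon> :: real assume "0 < \<epsilon>"
    then obtain N where N: "1 / real (Suc N) < \<epsilon>"
      using reals_Archimedean by (auto simp: inverse_eq_divide)
    define live where "live z \<longleftrightarrow> z \<in> L \<and> size_of (lab z) < N" for z
    define \<rho> where "\<rho> z = (if live z then osuc (r (height (lab z))) else 0)" for z
    have small: "g z \<in> {0..<\<epsilon>}" if "\<not> live z" for z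
    proof (cases "z \<in> L \<and> colour (lab z)")
      case True
      then have "1 / real (Suc (size_of (lab z))) \<le> 1 / real (Suc N)"
        using that by (intro divide_left_mono) (auto simp: live_def)
      then have "1 / real (Suc (size_of (lab z))) < \<epsilon>"
        using N by (rule le_less_trans)
      then show ?thesis
        using True by (simp add: g_def)
    next
      case False
      then have "g z = 0"
        unfolding g_def by (rule if_not_P)
      then show ?thesis
        using \<open>0 < \<epsilon>\<close> by simp
    qed
    have descend: "\<rho> z < \<rho> x" if "live x" "live z" "below q N (lab x) (lab z)" for x z
      using that less_iff[of "height (lab z)" "height (lab x)"]
      by (auto simp: \<rho>_def live_def below_def less_osuc_iff osuc_le_iff split: if_splits)
    have die: "\<not> live z" if "\<not> live x" "x \<in> L" "z \<in> L" "below q N (lab x) (lab z)" for x z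
      using that by (auto simp: live_def below_def split: if_splits)
    have dead: "\<rho> z = 0" if "\<not> live z" for z
      using that by (simp add: \<rho>_def)
    have alive: "\<rho> z \<noteq> 0" if "live z" for z
      using that by (simp add: \<rho>_def)
    have "local_rank K (osc_less g \<epsilon>) \<rho>"
    proof (rule local_rank_layered[OF lay(1,3)])
      show "\<rho> z \<le> \<rho> x" if "x \<in> L" "z \<in> L" "below q N (lab x) (lab z)" for x z
        using descend[of x z] die[of x z] dead[of z] that by (cases "live z") (auto intro: less_imp_le)
      fix x y z
      assume x: "x \<in> L" and *: "\<forall>u\<in>{y, z}. \<rho> u = \<rho> x \<and> (u \<in> L \<longrightarrow> u = x \<or> below q N (lab x) (lab u))"
      show "osc_less g \<epsilon> y z"
      proof (cases "live x")
        case True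
        have "u = x" if "u \<in> {y, z}" for u
        proof -
          have u: "\<rho> u = \<rho> x" "u \<in> L \<longrightarrow> u = x \<or> below q N (lab x) (lab u)"
            using * that by auto
          have live: "live u"
            using alive[OF True] dead[of u] u(1) by metis
          then have "\<not> below q N (lab x) (lab u)"
            using descend[OF True live] u(1) by auto
          with live u(2) show ?thesis
            by (auto simp: live_def)
        qed
        from this[of y] this[of z] show ?thesis
          using \<open>0 < \<epsilon>\<close> by simp
      next
        case False
        then have "\<not> live u" if "u \<in> {y, z}" for u
          using * that alive dead by metis
        then have "g y \<in> {0..<\<epsilon>}" "g z \<in> {0..<\<epsilon>}"
          using small by blast+
        then show ?thesis
          by auto
      qed
    qed (use \<open>0 < \<epsilon>\<close> in \<open>auto simp: g_def \<rho>_def live_def\<close>)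
    moreover have "\<rho> z < \<omega> ^\<^sub>o \<xi>2" for z
      using limit_osuc_less[OF limit_opow[OF \<xi>(4)] qr(2)] opow_pos by (simp add: \<rho>_def)
    ultimately show "\<exists>\<rho>. local_rank K (osc_less g \<epsilon>) \<rho> \<and> (\<forall>x\<in>K. \<rho> x < \<omega> ^\<^sub>o \<xi>2)"
      by blast
  qed (rule \<xi>)
  moreover have "\<theta> < osc_index K (\<lambda>x. f x * g x)"
    by (rule osc_index_layered[OF L(2,1) \<theta>1]) (simp add: f_def g_def)
  ultimately show ?thesis
    by blast
qed

lemma product_witness:
  fixes K :: "'a::metric_space set"
  assumes "closed K" and \<xi>: "\<xi>1 < \<omega>\<^sub>1" "\<xi>2 < \<omega>\<^sub>1"
    and \<theta>: "\<theta> < \<omega> ^\<^sub>o (\<xi>2 + \<xi>1)" and x: "x \<in> derived_set K \<theta>"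
  shows "\<exists>f\<in>baire1_class \<xi>1 K. \<exists>g\<in>baire1_class \<xi>2 K. \<theta> < osc_index K (\<lambda>x. f x * g x)"
proof (cases "\<xi>1 = 0 \<or> \<xi>2 = 0")
  case True
  then show ?thesis
  proof
    assume "\<xi>1 = 0"
    then obtain h where "h \<in> baire1_class \<xi>2 K" "\<theta> < osc_index K h"
      using single_witness[OF assms(1) \<xi>(2) _ x] \<theta> by auto
    then show ?thesis
      using const_baire1_class[OF \<xi>(1), of 1 K] by (intro bexI[of _ "\<lambda>_. 1"] bexI[of _ h]) auto
  next
    assume "\<xi>2 = 0"
    then obtain h where "h \<in> baire1_class \<xi>1 K" "\<theta> < osc_index K h"
      using single_witness[OF assms(1) \<xi>(1) _ x] \<theta> by auto
    then show ?thesis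
      using const_baire1_class[OF \<xi>(2), of 1 K] by (intro bexI[of _ h] bexI[of _ "\<lambda>_. 1"]) auto
  qed
next
  case False
  then show ?thesis
    using assms by (intro product_witness_pos) (auto simp: zero_less_iff opow_plus)
qed

text \<open>
  Both orders of the sum occur as exponents because either of the two functions can be the one that is constant on
  layers.
\<close>
theorem theorem6p7:
  fixes K :: "'a::metric_space set" and \<xi>1 \<xi>2 \<xi> :: ordinal
  assumes "\<xi>1 < \<omega>\<^sub>1" and "\<xi>2 < \<omega>\<^sub>1"
    and "\<xi> = max (\<xi>1 + \<xi>2) (\<xi>2 + \<xi>1)"
    and "compact K"
    and "derived_set K (\<omega> ^\<^sub>o \<xi>) \<noteq> {}"
  shows "Sup {osc_index K (\<lambda>x. f x * g x) | f g. f \<in> baire1_class \<xi>1 K \<and> g \<in> baire1_class \<xi>2 K}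
    = \<omega> ^\<^sub>o \<xi>"
proof -
  define S where "S = {osc_index K (\<lambda>x. f x * g x) | f g. f \<in> baire1_class \<xi>1 K \<and> g \<in> baire1_class \<xi>2 K}"
  have upper: "\<gamma> \<le> \<omega> ^\<^sub>o \<xi>" if "\<gamma> \<in> S" for \<gamma>
    using that osc_index_product_le[OF _ _ assms(1,2)] assms(3) unfolding S_def by blast
  have "closed K"
    using assms(4) by (rule compact_imp_closed)
  have witness: "\<exists>\<gamma>\<in>S. \<theta> < \<gamma>" if \<theta>: "\<theta> < \<omega> ^\<^sub>o \<xi>" for \<theta>
  proof -
    obtain x where x: "x \<in> derived_set K \<theta>"
      using derived_set_antimono[OF \<open>closed K\<close> less_imp_le[OF \<theta>]] assms(5) by blast
    consider "\<xi> = \<xi>2 + \<xi>1" | "\<xi> = \<xi>1 + \<xi>2"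
      using assms(3) by (metis max_def)
    then show ?thesis
    proof cases
      case 1
      then obtain f g where "f \<in> baire1_class \<xi>1 K" "g \<in> baire1_class \<xi>2 K"
        "\<theta> < osc_index K (\<lambda>x. f x * g x)"
        using product_witness[OF \<open>closed K\<close> assms(1,2) _ x] \<theta> by blast
      then show ?thesis
        unfolding S_def by blast
    next
      case 2
      then obtain g f where "g \<in> baire1_class \<xi>2 K" "f \<in> baire1_class \<xi>1 K"
        "\<theta> < osc_index K (\<lambda>x. g x * f x)"
        using product_witness[OF \<open>closed K\<close> assms(2,1) _ x] \<theta> by blast
      moreover have "(\<lambda>x. g x * f x) = (\<lambda>x. f x * g x)"
        by (simp add: mult.commute)
      ultimately show ?thesis
        unfolding S_def by auto
    qed
  qed
  have "S \<noteq> {}"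
    using witness[OF opow_pos] by blast
  have "Sup S = \<omega> ^\<^sub>o \<xi>"
  proof (rule antisym)
    show "Sup S \<le> \<omega> ^\<^sub>o \<xi>"
      using \<open>S \<noteq> {}\<close> upper by (rule cSup_least)
    show "\<omega> ^\<^sub>o \<xi> \<le> Sup S"
    proof (rule ccontr)
      assume "\<not> \<omega> ^\<^sub>o \<xi> \<le> Sup S"
      then obtain \<gamma> where "\<gamma> \<in> S" "Sup S < \<gamma>"
        using witness by (metis not_le)
      moreover have "bdd_above S"
        using upper by (auto simp: bdd_above_def)
      ultimately show False
        using cSup_upper by (metis not_le)
    qed
  qed
  then show ?thesis
    by (simp add: S_def)
qed

end
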